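(* Suppose that $Q$ is a family of seminorms on a locally convex space $E$ which determines the topology of $E$. Let $E$ be separated and sequentially complete. If $E$ has the weakly fixed point property, then $E$ has the weakly fixed point property for commuting separable semitopological semigroups.
   Context: For $C\subset E$, a mapping $T:C\to C$ is $Q$-nonexpansive if $q(Tx-Ty)\le q(x-y)$ for all $x,y\in C$ and $q\in Q$. $E$ is separated if and only if for every $x\in E\setminus\{0\}$ there is $q\in Q$ with $q(x)\neq 0$. $E$ has the weakly fixed point property (relative to $Q$) if for every nonempty weakly compact convex subset $C$ of $E$, every $Q$-nonexpansive mapping of $C$ into itself has a fixed point. A semitopological semigroup is a semigroup $S$ with a Hausdorff topology such that for each $a\in S$ the mappings $s\mapsto as$ and $s\mapsto sa$ from $S$ to $S$ are continuous; it is separable if it has a countable dense subset, and commuting means commutative. A representation of $S$ as $Q$-nonexpansive mappings on $C$ is a family $\mathcal{S}=\{T_s:s\in S\}$ of $Q$-nonexpansive mappings from $C$ into itself such that $T_{st}x=T_sT_tx$ for all $s,t\in S$ and $x\in C$; its set of common fixed points is $\mathrm{Fix}(\mathcal{S})=\bigcap_{s\in S}\{x\in C:T_sx=x\}$. $E$ has the weakly fixed point property for commuting separable semitopological semigroups if for every nonempty weakly compact convex subset $C$ of $E$ and every commuting separable semitopological semigroup $S$, every representation $\mathcal{S}$ of $S$ as $Q$-nonexpansive mappings on $C$ has $\mathrm{Fix}(\mathcal{S})\neq\emptyset$. *)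

theory Defs
  imports "HOL-Analysis.Analysis"
begin

text \<open>
  A locally convex space has all of a type \<^typ>\<open>'a\<close> of class \<^class>\<open>real_vector\<close> as its
  underlying vector space and an explicit topology \<open>X\<close> on that type. Every real vector space
  can serve as \<^typ>\<open>'a\<close>. A complex space is covered by restricting scalars: its seminorms,
  its convex sets and its weak topology are not affected by this.
\<close>

definition locally_convex_space :: "'a::real_vector topology \<Rightarrow> bool" where
  "locally_convex_space X \<longleftrightarrow>
     topspace X = UNIV \<and>
     continuous_map (prod_topology X X) X (\<lambda>(x, y). x + y) \<and>
     continuous_map (prod_topology euclideanreal X) X (\<lambda>(c, x). c *\<^sub>R x) \<and>
     (\<forall>U. openin X U \<and> 0 \<in> U \<longrightarrow> (\<exists>V. openin X V \<and> 0 \<in> V \<and> convex V \<and> V \<subseteq> U))"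

definition seminorm :: "('a::real_vector \<Rightarrow> real) \<Rightarrow> bool" where
  "seminorm q \<longleftrightarrow>
     (\<forall>x. 0 \<le> q x) \<and> (\<forall>x y. q (x + y) \<le> q x + q y) \<and> (\<forall>c x. q (c *\<^sub>R x) = \<bar>c\<bar> * q x)"

text \<open>
  The finite intersections of open \<open>q\<close>-balls, \<open>q \<in> Q\<close>, centred at a point form a
  neighbourhood base there; \<open>Q\<close> need not be directed. For \<open>F = {}\<close> the intersection is the
  whole space, so the empty family determines the indiscrete topology.
\<close>

definition determines_topology :: "('a::real_vector \<Rightarrow> real) set \<Rightarrow> 'a topology \<Rightarrow> bool" where
  "determines_topology Q X \<longleftrightarrow>
     (\<forall>U. openin X U \<longleftrightarrow>
        (\<forall>x\<in>U. \<exists>F r. finite F \<and> F \<subseteq> Q \<and> 0 < r \<and> {y. \<forall>q\<in>F. q (y - x) < r} \<subseteq> U))"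

definition separated :: "('a::real_vector \<Rightarrow> real) set \<Rightarrow> bool" where
  "separated Q \<longleftrightarrow> (\<forall>x. x \<noteq> 0 \<longrightarrow> (\<exists>q\<in>Q. q x \<noteq> 0))"

definition sequentially_complete :: "'a::real_vector topology \<Rightarrow> bool" where
  "sequentially_complete X \<longleftrightarrow>
     (\<forall>\<sigma> :: nat \<Rightarrow> 'a.
        (\<forall>U. openin X U \<and> 0 \<in> U \<longrightarrow> (\<exists>N. \<forall>m\<ge>N. \<forall>n\<ge>N. \<sigma> m - \<sigma> n \<in> U)) \<longrightarrow>
        (\<exists>l. limitin X \<sigma> l sequentially))"

text \<open>The coarsest topology for which every \<open>X\<close>-continuous linear functional is continuous.\<close>

definition weak_topology :: "'a::real_vector topology \<Rightarrow> 'a topology" where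
  "weak_topology X =
     topology_generated_by
       {f -` U | (f :: 'a \<Rightarrow> real) U. linear f \<and> continuous_map X euclideanreal f \<and> open U}"

abbreviation weakly_compact :: "'a::real_vector topology \<Rightarrow> 'a set \<Rightarrow> bool" where
  "weakly_compact X C \<equiv> compactin (weak_topology X) C"

definition nonexpansive_on ::
  "('a::real_vector \<Rightarrow> real) set \<Rightarrow> 'a set \<Rightarrow> ('a \<Rightarrow> 'a) \<Rightarrow> bool" where
  "nonexpansive_on Q C T \<longleftrightarrow>
     T \<in> C \<rightarrow> C \<and> (\<forall>x\<in>C. \<forall>y\<in>C. \<forall>q\<in>Q. q (T x - T y) \<le> q (x - y))"

definition weakly_fpp :: "'a::real_vector topology \<Rightarrow> ('a \<Rightarrow> real) set \<Rightarrow> bool" where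
  "weakly_fpp X Q \<longleftrightarrow>
     (\<forall>C T. C \<noteq> {} \<and> weakly_compact X C \<and> convex C \<and> nonexpansive_on Q C T \<longrightarrow>
        (\<exists>x\<in>C. T x = x))"

text \<open>The carrier of the semigroup is the underlying set of its topology \<open>S\<close>.\<close>

definition semitopological_semigroup :: "'s topology \<Rightarrow> ('s \<Rightarrow> 's \<Rightarrow> 's) \<Rightarrow> bool" where
  "semitopological_semigroup S mul \<longleftrightarrow>
     (\<forall>a\<in>topspace S. \<forall>b\<in>topspace S. mul a b \<in> topspace S) \<and>
     (\<forall>a\<in>topspace S. \<forall>b\<in>topspace S. \<forall>c\<in>topspace S.
        mul (mul a b) c = mul a (mul b c)) \<and>
     Hausdorff_space S \<and>
     (\<forall>a\<in>topspace S.
        continuous_map S S (\<lambda>s. mul a s) \<and> continuous_map S S (\<lambda>s. mul s a))"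

definition commuting :: "'s topology \<Rightarrow> ('s \<Rightarrow> 's \<Rightarrow> 's) \<Rightarrow> bool" where
  "commuting S mul \<longleftrightarrow> (\<forall>a\<in>topspace S. \<forall>b\<in>topspace S. mul a b = mul b a)"

text \<open>No continuity of \<open>(s, x) \<mapsto> T s x\<close>, joint or separate, is part of the notion.\<close>

definition nonexpansive_representation ::
  "('a::real_vector \<Rightarrow> real) set \<Rightarrow> 'a set \<Rightarrow> 's topology \<Rightarrow> ('s \<Rightarrow> 's \<Rightarrow> 's) \<Rightarrow>
     ('s \<Rightarrow> 'a \<Rightarrow> 'a) \<Rightarrow> bool" where
  "nonexpansive_representation Q C S mul T \<longleftrightarrow>
     (\<forall>s\<in>topspace S. nonexpansive_on Q C (T s)) \<and>
     (\<forall>s\<in>topspace S. \<forall>t\<in>topspace S. \<forall>x\<in>C. T (mul s t) x = T s (T t x))"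

definition Fix :: "'a set \<Rightarrow> 's topology \<Rightarrow> ('s \<Rightarrow> 'a \<Rightarrow> 'a) \<Rightarrow> 'a set" where
  "Fix C S T = (\<Inter>s\<in>topspace S. {x \<in> C. T s x = x})"

text \<open>
  The property quantifies over all commuting separable semitopological semigroups. A formula
  can only range over those whose elements lie in one type \<^typ>\<open>'s\<close>, which is therefore a
  parameter; a theorem that leaves \<^typ>\<open>'s\<close> free asserts the property for all semigroups.
\<close>

definition weakly_fpp_commuting_separable ::
  "'s itself \<Rightarrow> 'a::real_vector topology \<Rightarrow> ('a \<Rightarrow> real) set \<Rightarrow> bool" where
  "weakly_fpp_commuting_separable (_ :: 's itself) X Q \<longleftrightarrow>
     (\<forall>C (S :: 's topology) mul T.
        C \<noteq> {} \<and> weakly_compact X C \<and> convex C \<and>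
        semitopological_semigroup S mul \<and> commuting S mul \<and> separable_space S \<and>
        nonexpansive_representation Q C S mul T \<longrightarrow>
        Fix C S T \<noteq> {})"

end

theory Submission
  imports Defs
begin

text \<open>
  By Bruck's theorem the fixed point set of a single nonexpansive self-map of \<open>C\<close> is a nonexpansive
  retract of \<open>C\<close>, so the same holds for finitely many commuting maps. For countably many, one
  applies the fixed point property to a weighted series of the retractions, which converges by
  sequential completeness. For an arbitrary commuting family and one seminorm \<open>q\<close>, a closing-off
  argument reduces to a countable subfamily acting on a \<open>q\<close>-separable subset, and yields a point
  that is fixed modulo \<open>q\<close>. In a minimal weakly compact convex invariant set \<open>M\<close>, the points at
  \<open>q\<close>-distance 0 from such a point form an invariant convex set, hence all of \<open>M\<close>; as this holds for
  every \<open>q\<close> and \<open>E\<close> is separated, \<open>M\<close> is a single point.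
\<close>

section \<open>Sublinear functionals and the Hahn-Banach theorem\<close>

text \<open>Nonexpansive maps need not be weakly continuous, and their fixed point sets need be
  neither convex nor weakly closed. So a decreasing sequence of fixed point sets cannot simply be
  intersected by weak compactness, nor can the fixed point property be applied on such sets. This is
  why retractions are carried along: they are self-maps of the convex set \<open>C\<close>, and so
  are their averages. The sets to which the property is applied must be shown weakly compact and
  convex. They arise either as images of a compact space of maps or as weakly closed parts of weakly
  compact sets; Hahn-Banach enters because convex functions dominated by finitely many members of
  \<open>Q\<close> have weakly closed sublevel sets. Convergence of the averages needs each seminorm
  to be bounded on \<open>C\<close>, a uniform boundedness statement. The restriction to one
  seminorm at a time comes from the supremum of \<open>q (T d - d)\<close>: a sequence of maps
  approximates it for one \<open>q\<close>, but different, possibly uncountably many, seminorms may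
  require different sequences.\<close>

definition sublinear :: "('a::real_vector \<Rightarrow> real) \<Rightarrow> bool" where
  "sublinear p \<longleftrightarrow> (\<forall>x y. p (x + y) \<le> p x + p y) \<and> (\<forall>c x. 0 < c \<longrightarrow> p (c *\<^sub>R x) = c * p x)"

lemma sublinear_0: "sublinear p \<Longrightarrow> p 0 = 0"
proof -
  assume "sublinear p"
  then have "p ((2::real) *\<^sub>R 0) = 2 * p 0"
    unfolding sublinear_def by (metis zero_less_numeral)
  then show ?thesis by simp
qed

lemma sublinear_minus_le:
  assumes "sublinear p"
  shows "- p (- x) \<le> p x"
proof -
  have "p (x + (- x)) \<le> p x + p (- x)"
    using assms unfolding sublinear_def by blast
  then show ?thesis
    using sublinear_0[OF assms] by simp
qed

lemma sublinear_imp_convex_on: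
  assumes "sublinear p"
  shows "convex_on UNIV p"
proof (intro convex_onI)
  fix t :: real and x y assume "0 < t" "t < 1"
  have "p ((1 - t) *\<^sub>R x + t *\<^sub>R y) \<le> p ((1 - t) *\<^sub>R x) + p (t *\<^sub>R y)"
    using assms unfolding sublinear_def by blast
  also have "\<dots> = (1 - t) * p x + t * p y"
    using assms \<open>0 < t\<close> \<open>t < 1\<close> unfolding sublinear_def by simp
  finally show "p ((1 - t) *\<^sub>R x + t *\<^sub>R y) \<le> (1 - t) * p x + t * p y" .
qed auto

text \<open>\<open>g\<close> is the one-sided directional derivative of \<open>\<phi>\<close> at
  \<open>a\<close>. The difference quotients of a convex function decrease as \<open>t\<close>
  decreases to 0, so the limit can be written as an infimum; the bound by \<open>p\<close> keeps it
  finite.\<close>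

lemma directional_derivative_sublinear:
  assumes \<phi>: "convex_on UNIV \<phi>" and p: "sublinear p" and lip: "\<And>x v. \<phi> (x + v) \<le> \<phi> x + p v"
  obtains g where "sublinear g" "\<And>v. g v \<le> p v" "\<And>v. g v \<le> \<phi> (a + v) - \<phi> a"
proof -
  define D where "D t v = (\<phi> (a + t *\<^sub>R v) - \<phi> a) / t" for t v
  define g where "g v = (INF t\<in>{0<..}. D t v)" for v
  have lower: "- p (- v) \<le> D t v" and upper: "D t v \<le> p v" if "0 < t" for t v
  proof -
    have "\<phi> a \<le> \<phi> (a + t *\<^sub>R v) + p (t *\<^sub>R (- v))"
      using lip[of "a + t *\<^sub>R v" "t *\<^sub>R (- v)"] by simp
    also have "p (t *\<^sub>R (- v)) = t * p (- v)"
      using p that unfolding sublinear_def by blast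
    finally show "- p (- v) \<le> D t v"
      using that by (simp add: D_def field_simps)
    have "\<phi> (a + t *\<^sub>R v) \<le> \<phi> a + p (t *\<^sub>R v)"
      by (rule lip)
    also have "p (t *\<^sub>R v) = t * p v"
      using p that unfolding sublinear_def by blast
    finally show "D t v \<le> p v"
      using that by (simp add: D_def field_simps)
  qed
  have bdd: "bdd_below ((\<lambda>t. D t v) ` {0<..})" for v
    using lower by (intro bdd_belowI2[where m = "- p (- v)"]) auto
  have g_le: "g v \<le> D t v" if "0 < t" for t v
    unfolding g_def using bdd that by (intro cINF_lower) auto
  have le_g: "m \<le> g v" if "\<And>t. 0 < t \<Longrightarrow> m \<le> D t v" for m v
    unfolding g_def using that by (intro cINF_greatest) auto
  have add: "g (u + v) \<le> D t u + D s v" if "0 < t" "0 < s" for t s u v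
  proof -
    \<comment> \<open>\<open>\<theta>\<close> solves \<open>1 / \<theta> = 1 / t + 1 / s\<close>.
      This makes \<open>a + \<theta> *\<^sub>R (u + v)\<close> a convex combination of
      \<open>a + t *\<^sub>R u\<close> and \<open>a + s *\<^sub>R v\<close>, so two unrelated step
      sizes are merged without appeal to monotonicity of the quotients.\<close>
    define \<theta> where "\<theta> = s * t / (t + s)"
    have pos: "0 < \<theta>" "0 < t + s"
      using that by (auto simp: \<theta>_def)
    have coef: "\<theta> / t = s / (t + s)" "\<theta> / s = t / (t + s)" "1 - \<theta> / s = \<theta> / t"
      using that pos by (auto simp: \<theta>_def divide_simps)
    have "a + \<theta> *\<^sub>R (u + v) = (1 - \<theta> / s) *\<^sub>R (a + t *\<^sub>R u) + (\<theta> / s) *\<^sub>R (a + s *\<^sub>R v)"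
    proof -
      have "(1 - \<theta> / s) * t = \<theta>" "(\<theta> / s) * s = \<theta>"
        using that by (simp_all add: coef(3))
      then have "(1 - \<theta> / s) *\<^sub>R (t *\<^sub>R u) = \<theta> *\<^sub>R u" "(\<theta> / s) *\<^sub>R (s *\<^sub>R v) = \<theta> *\<^sub>R v"
        by (simp_all only: scaleR_scaleR)
      moreover have "(1 - \<theta> / s) *\<^sub>R a + (\<theta> / s) *\<^sub>R a = a"
        by (simp flip: scaleR_add_left)
      ultimately show ?thesis
        by (simp only: scaleR_add_right) (metis add.assoc add.left_commute)
    qed
    then have "\<phi> (a + \<theta> *\<^sub>R (u + v)) \<le> (1 - \<theta> / s) * \<phi> (a + t *\<^sub>R u) + (\<theta> / s) * \<phi> (a + s *\<^sub>R v)"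
      using convex_onD[OF \<phi>, of "\<theta> / s" "a + t *\<^sub>R u" "a + s *\<^sub>R v"] coef(2) that pos by simp
    then have "\<phi> (a + \<theta> *\<^sub>R (u + v)) - \<phi> a \<le> (\<theta> / t) * (\<phi> (a + t *\<^sub>R u) - \<phi> a) + (\<theta> / s) * (\<phi> (a + s *\<^sub>R v) - \<phi> a)"
      unfolding coef(3)[symmetric] by (simp add: algebra_simps)
    also have "\<dots> = \<theta> * (D t u + D s v)"
      by (simp add: D_def distrib_left)
    finally have "D \<theta> (u + v) \<le> D t u + D s v"
      using pos by (simp add: D_def field_simps)
    with g_le[OF pos(1)] show ?thesis
      by (rule order_trans)
  qed
  have scale: "c * g v \<le> g (c *\<^sub>R v)" if "0 < c" for c v
  proof (rule le_g)
    fix t :: real assume "0 < t"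
    have "c * g v \<le> c * D (t * c) v"
      using g_le[of "t * c" v] that \<open>0 < t\<close> by simp
    also have "\<dots> = D t (c *\<^sub>R v)"
      using that \<open>0 < t\<close> by (simp add: D_def)
    finally show "c * g v \<le> D t (c *\<^sub>R v)" .
  qed
  show thesis
  proof
    have "g (u + v) \<le> g u + g v" for u v
    proof -
      have "g (u + v) - g v \<le> D t u" if "0 < t" for t
        using le_g[of "g (u + v) - D t u" v] add[OF that] by (force simp: algebra_simps)
      then have "g (u + v) - g v \<le> g u"
        by (rule le_g)
      then show ?thesis by simp
    qed
    moreover have "g (c *\<^sub>R v) = c * g v" if "0 < c" for c v
    proof (rule antisym)
      show "g (c *\<^sub>R v) \<le> c * g v"
        using scale[of "inverse c" "c *\<^sub>R v"] that by (simp add: field_simps)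
    qed (rule scale[OF that])
    ultimately show "sublinear g"
      unfolding sublinear_def by blast
    show "g v \<le> p v" for v
      using g_le[of 1 v] upper[of 1 v] by simp
    show "g v \<le> \<phi> (a + v) - \<phi> a" for v
      using g_le[of 1 v] by (simp add: D_def)
  qed
qed

text \<open>Subadditivity of a pointwise infimum rests on the chain condition: given
  \<open>h\<close> and \<open>k\<close>, the smaller one estimates the value at \<open>x + y\<close>
  by both. The common majorant \<open>p\<close> bounds all members below by
  \<open>- p (- x)\<close>, so the infimum is finite.\<close>

lemma sublinear_INF_chain:
  assumes "\<C> \<noteq> {}" and sub: "\<And>h. h \<in> \<C> \<Longrightarrow> sublinear h" "\<And>h x. h \<in> \<C> \<Longrightarrow> h x \<le> p x"
    and chain: "\<And>h k. h \<in> \<C> \<Longrightarrow> k \<in> \<C> \<Longrightarrow> h \<le> k \<or> k \<le> h"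
  shows "sublinear (\<lambda>x. INF h\<in>\<C>. h x)" "\<And>h x. h \<in> \<C> \<Longrightarrow> (INF h\<in>\<C>. h x) \<le> h x"
proof -
  define g where "g x = (INF h\<in>\<C>. h x)" for x
  have "- p (- x) \<le> h x" if "h \<in> \<C>" for h x
    using sub(2)[OF that, of "- x"] sublinear_minus_le[OF sub(1)[OF that], of x] by linarith
  then have "bdd_below ((\<lambda>h. h x) ` \<C>)" for x
    by (intro bdd_belowI2[where m = "- p (- x)"])
  then have g_le: "g x \<le> h x" if "h \<in> \<C>" for h x
    unfolding g_def using that by (intro cINF_lower) auto
  have le_g: "m \<le> g x" if "\<And>h. h \<in> \<C> \<Longrightarrow> m \<le> h x" for m x
    unfolding g_def using that \<open>\<C> \<noteq> {}\<close> by (intro cINF_greatest) auto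
  show "(INF h\<in>\<C>. h x) \<le> h x" if "h \<in> \<C>" for h x
    using g_le[OF that] unfolding g_def .
  have add: "g (x + y) \<le> h x + k y" if hk: "h \<in> \<C>" "k \<in> \<C>" for h k x y
  proof -
    obtain l where l: "l \<in> \<C>" "l \<le> h" "l \<le> k"
      using chain[OF hk] hk by blast
    have "g (x + y) \<le> l (x + y)" by (rule g_le[OF l(1)])
    also have "\<dots> \<le> l x + l y" using sub(1)[OF l(1)] unfolding sublinear_def by blast
    also have "\<dots> \<le> h x + k y" using l(2,3) by (simp add: add_mono le_funD)
    finally show ?thesis .
  qed
  have "g (x + y) \<le> g x + g y" for x y
  proof -
    have "g (x + y) - g y \<le> h x" if "h \<in> \<C>" for h
      using le_g[of "g (x + y) - h x" y] add[OF that] by (force simp: algebra_simps)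
    then have "g (x + y) - g y \<le> g x"
      by (rule le_g)
    then show ?thesis by simp
  qed
  moreover have scale: "c * g x \<le> g (c *\<^sub>R x)" if "0 < c" for c x
  proof (rule le_g)
    fix h assume h: "h \<in> \<C>"
    then have "h (c *\<^sub>R x) = c * h x" using sub(1) that unfolding sublinear_def by blast
    then show "c * g x \<le> h (c *\<^sub>R x)" using g_le[OF h, of x] that by simp
  qed
  moreover have "g (c *\<^sub>R x) = c * g x" if "0 < c" for c x
    using scale[of "inverse c" "c *\<^sub>R x"] scale[OF that, of x] that by (simp add: field_simps)
  ultimately have "sublinear g"
    unfolding sublinear_def by blast
  then show "sublinear (\<lambda>x. INF h\<in>\<C>. h x)"
    unfolding g_def .
qed

text \<open>A minimal sublinear functional coincides with its directional derivative in every direction,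
  which makes it odd.\<close>

lemma Hahn_Banach_sublinear:
  assumes p: "sublinear p"
  obtains f where "linear f" "\<And>x. f x \<le> p x"
proof -
  define A where "A = {h. sublinear h \<and> h \<le> p}"
  have "\<exists>f\<in>A. \<forall>h\<in>A. f \<ge> h \<longrightarrow> h = f"
  proof (rule predicate_Zorn)
    show "partial_order_on A (relation_of (\<ge>) A)"
      by (rule partial_order_on_relation_ofI) auto
    fix \<C> assume \<C>: "\<C> \<in> Chains (relation_of (\<ge>) A)"
    show "\<exists>u\<in>A. \<forall>h\<in>\<C>. h \<ge> u"
    proof (cases "\<C> = {}")
      case False
      have sub: "\<C> \<subseteq> A" and chain: "h \<le> k \<or> k \<le> h" if "h \<in> \<C>" "k \<in> \<C>" for h k
        using \<C> that unfolding Chains_def relation_of_def by auto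
      have 1: "sublinear h" "h x \<le> p x" if "h \<in> \<C>" for h x
        using sub that by (auto simp: A_def le_fun_def)
      have inf: "sublinear (\<lambda>x. INF h\<in>\<C>. h x)" "\<And>h x. h \<in> \<C> \<Longrightarrow> (INF h\<in>\<C>. h x) \<le> h x"
        using sublinear_INF_chain[of \<C> p] False 1 chain by blast+
      show ?thesis
      proof
        show "\<forall>h\<in>\<C>. h \<ge> (\<lambda>x. INF h\<in>\<C>. h x)"
          using inf(2) by (auto simp: le_fun_def)
        show "(\<lambda>x. INF h\<in>\<C>. h x) \<in> A"
          using inf False 1(2) unfolding A_def le_fun_def by (blast intro: order_trans)
      qed
    qed (use p in \<open>auto simp: A_def\<close>)
  qed
  then obtain f where "f \<in> A" and A: "\<And>h. h \<in> A \<Longrightarrow> h \<le> f \<Longrightarrow> h = f"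
    by blast
  then have f: "sublinear f" "f \<le> p"
    by (auto simp: A_def)
  have min: "h = f" if "sublinear h" "h \<le> f" for h
    using that f order_trans by (intro A) (auto simp: A_def)
  have odd: "f (- a) = - f a" for a
  proof -
    have "f (x + v) \<le> f x + f v" for x v
      using f unfolding sublinear_def by blast
    then obtain g where g: "sublinear g" "\<And>v. g v \<le> f v" "\<And>v. g v \<le> f (a + v) - f a"
      using directional_derivative_sublinear[OF sublinear_imp_convex_on[OF f(1)] f(1), of a] by blast
    then have "g = f"
      by (intro min) (auto simp: le_fun_def)
    then have "f (- a) \<le> - f a"
      using g(3)[of "- a"] sublinear_0[OF f(1)] by simp
    then show ?thesis
      using sublinear_minus_le[OF f(1), of a] by linarith
  qed
  have le: "f (x + y) \<le> f x + f y" for x y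
    using f unfolding sublinear_def by blast
  have "linear f"
  proof (rule linearI)
    show "f (x + y) = f x + f y" for x y
      using le[of x y] le[of "- x" "- y"] odd[of "x + y"] odd[of x] odd[of y] by simp
    have pos: "f (c *\<^sub>R x) = c * f x" if "0 < c" for c x
      using f that unfolding sublinear_def by blast
    show "f (c *\<^sub>R x) = c *\<^sub>R f x" for c x
      using pos[of c x] pos[of "- c" x] odd[of "c *\<^sub>R x"] sublinear_0[OF f(1)]
      by (cases c "0::real" rule: linorder_cases) auto
  qed
  with f(2) that show thesis
    by (auto simp: le_fun_def)
qed

text \<open>A linear functional below the directional derivative at \<open>a\<close> is a
  subgradient there. The bound by \<open>p\<close> is kept because it yields continuity when
  \<open>p\<close> is a finite sum of members of \<open>Q\<close>.\<close>

lemma convex_on_subgradient: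
  assumes "convex_on UNIV \<phi>" "sublinear p" "\<And>x v. \<phi> (x + v) \<le> \<phi> x + p v"
  obtains f where "linear f" "\<And>v. f v \<le> p v" "\<And>y. \<phi> a + f (y - a) \<le> \<phi> y"
proof -
  obtain g where g: "sublinear g" "\<And>v. g v \<le> p v" "\<And>v. g v \<le> \<phi> (a + v) - \<phi> a"
    using directional_derivative_sublinear[OF assms, where a = a] by blast
  obtain f where f: "linear f" "\<And>x. f x \<le> g x"
    using Hahn_Banach_sublinear[OF g(1)] by blast
  show thesis
  proof
    show "f v \<le> p v" for v
      using f(2)[of v] g(2)[of v] by linarith
    show "\<phi> a + f (y - a) \<le> \<phi> y" for y
      using f(2)[of "y - a"] g(3)[of "y - a"] by simp
  qed (fact f(1))
qed

section \<open>Seminorms and the weak topology\<close>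

lemma seminorm_nonneg: "seminorm q \<Longrightarrow> 0 \<le> q x"
  and seminorm_add_le: "seminorm q \<Longrightarrow> q (x + y) \<le> q x + q y"
  and seminorm_scaleR: "seminorm q \<Longrightarrow> q (c *\<^sub>R x) = \<bar>c\<bar> * q x"
  unfolding seminorm_def by blast+

lemma seminorm_0: "seminorm q \<Longrightarrow> q 0 = 0"
  using seminorm_scaleR[of q 0 0] by simp

lemma seminorm_minus: "seminorm q \<Longrightarrow> q (- x) = q x"
  using seminorm_scaleR[of q "-1" x] by simp

lemma seminorm_diff_commute: "seminorm q \<Longrightarrow> q (x - y) = q (y - x)"
  using seminorm_minus[of q "x - y"] by simp

lemma seminorm_diff_triangle: "seminorm q \<Longrightarrow> q (x - z) \<le> q (x - y) + q (y - z)"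
  using seminorm_add_le[of q "x - y" "y - z"] by simp

lemma seminorm_sublinear: "seminorm q \<Longrightarrow> sublinear q"
  unfolding seminorm_def sublinear_def by simp

lemma seminorm_sum:
  assumes "\<And>q. q \<in> F \<Longrightarrow> seminorm q"
  shows "seminorm (\<lambda>x. \<Sum>q\<in>F. q x)"
  unfolding seminorm_def
proof (intro conjI allI)
  show "0 \<le> (\<Sum>q\<in>F. q x)" for x
    using assms by (auto intro!: sum_nonneg simp: seminorm_nonneg)
  show "(\<Sum>q\<in>F. q (x + y)) \<le> (\<Sum>q\<in>F. q x) + (\<Sum>q\<in>F. q y)" for x y
    using assms by (auto intro!: sum_mono simp: seminorm_add_le simp flip: sum.distrib)
  show "(\<Sum>q\<in>F. q (c *\<^sub>R x)) = \<bar>c\<bar> * (\<Sum>q\<in>F. q x)" for c x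
    using assms by (simp add: seminorm_scaleR sum_distrib_left)
qed

lemma seminorm_diff_convex_on:
  assumes "seminorm q"
  shows "convex_on UNIV (\<lambda>y. q (y - a))"
proof (intro convex_onI)
  fix t :: real and x y assume t: "0 < t" "t < 1"
  have "q ((1 - t) *\<^sub>R x + t *\<^sub>R y - a) = q ((1 - t) *\<^sub>R (x - a) + t *\<^sub>R (y - a))"
    by (simp add: algebra_simps)
  also have "\<dots> \<le> (1 - t) * q (x - a) + t * q (y - a)"
    using seminorm_add_le[OF assms, of "(1 - t) *\<^sub>R (x - a)" "t *\<^sub>R (y - a)"] t
    by (simp add: seminorm_scaleR[OF assms])
  finally show "q ((1 - t) *\<^sub>R x + t *\<^sub>R y - a) \<le> (1 - t) * q (x - a) + t * q (y - a)" .
qed auto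

section \<open>The weak topology as an initial topology\<close>

lemma topspace_weak_topology [simp]: "topspace (weak_topology X) = UNIV"
proof -
  have "linear (\<lambda>x::'a. 0::real)" "continuous_map X euclideanreal (\<lambda>x. 0)"
    by (auto intro: linearI)
  then have "(\<lambda>x. 0::real) -` UNIV \<in> {f -` U | (f :: 'a \<Rightarrow> real) U. linear f \<and> continuous_map X euclideanreal f \<and> open U}"
    by blast
  then show ?thesis
    unfolding weak_topology_def topology_generated_by_topspace by auto
qed

lemma continuous_map_weak_functional:
  assumes "linear g" "continuous_map X euclideanreal g"
  shows "continuous_map (weak_topology X) euclideanreal g"
  unfolding continuous_map_def
proof (intro conjI allI impI)
  fix U :: "real set" assume "openin euclidean U"
  then have "openin (weak_topology X) (g -` U)"
    unfolding weak_topology_def using assms by (intro topology_generated_by_Basis) auto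
  then show "openin (weak_topology X) {x \<in> topspace (weak_topology X). g x \<in> U}"
    by (simp add: vimage_def)
qed auto

lemma continuous_map_into_weak_topology:
  assumes "\<And>g. linear g \<Longrightarrow> continuous_map X euclideanreal g \<Longrightarrow> continuous_map Y euclideanreal (\<lambda>y. g (u y))"
  shows "continuous_map Y (weak_topology X) u"
  unfolding weak_topology_def
proof (rule continuous_on_generated_topo)
  fix V assume "V \<in> {f -` U |f U. linear f \<and> continuous_map X euclideanreal f \<and> open (U :: real set)}"
  then obtain f U where V: "V = f -` U" "linear f" "continuous_map X euclideanreal f" "open (U :: real set)"
    by blast
  have "openin Y {y \<in> topspace Y. f (u y) \<in> U}"
    using assms[OF V(2,3)] V(4) by (auto simp: continuous_map_def)
  then show "openin Y (u -` V \<inter> topspace Y)"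
    unfolding V(1) by (simp add: vimage_def Int_def conj_commute)
next
  have "topspace (weak_topology X) = UNIV" by simp
  then show "u ` topspace Y \<subseteq> \<Union> {f -` U |f U. linear f \<and> continuous_map X euclideanreal f \<and> open (U :: real set)}"
    unfolding weak_topology_def topology_generated_by_topspace by simp
qed

lemma continuous_map_weak_diff:
  fixes X :: "'a::real_vector topology"
  assumes "continuous_map Y (weak_topology X) u" "continuous_map Y (weak_topology X) v"
  shows "continuous_map Y (weak_topology X) (\<lambda>y. u y - v y)"
proof (rule continuous_map_into_weak_topology)
  fix g :: "'a \<Rightarrow> real" assume g: "linear g" "continuous_map X euclideanreal g"
  note W = continuous_map_weak_functional[OF g]
  have "continuous_map Y euclideanreal (\<lambda>y. g (u y) - g (v y))"
    using continuous_map_compose[OF assms(1) W] continuous_map_compose[OF assms(2) W]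
    by (intro continuous_map_diff) (auto simp: o_def)
  then show "continuous_map Y euclideanreal (\<lambda>y. g (u y - v y))"
    by (simp add: linear_diff[OF g(1)])
qed

section \<open>Continuous functionals and weakly closed sets determined by the seminorms\<close>

locale separated_lcs =
  fixes X :: "'a::real_vector topology" and Q :: "('a \<Rightarrow> real) set"
  assumes topspace_X: "topspace X = UNIV"
    and seminorm: "\<And>q. q \<in> Q \<Longrightarrow> seminorm q"
    and determines: "determines_topology Q X"
    and separated: "separated Q"
begin

lemma openin_X: "openin X U \<longleftrightarrow>
        (\<forall>x\<in>U. \<exists>F r. finite F \<and> F \<subseteq> Q \<and> 0 < r \<and> {y. \<forall>q\<in>F. q (y - x) < r} \<subseteq> U)"
  using determines[unfolded determines_topology_def] by (rule spec)

lemma seminorm_finite_sum: "F \<subseteq> Q \<Longrightarrow> seminorm (\<lambda>x. \<Sum>q\<in>F. q x)"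
  using seminorm by (blast intro: seminorm_sum)

text \<open>Equality is phrased with \<open>\<le> 0\<close> because conditions of the form
  \<open>q (u y) \<le> c\<close> are the ones available as closed conditions in the weak
  topology.\<close>

lemma eq_iff_seminorms: "x = y \<longleftrightarrow> (\<forall>q\<in>Q. q (x - y) \<le> 0)"
proof
  show "x = y \<Longrightarrow> \<forall>q\<in>Q. q (x - y) \<le> 0"
    using seminorm by (auto simp: seminorm_0)
  assume "\<forall>q\<in>Q. q (x - y) \<le> 0"
  then have "\<forall>q\<in>Q. q (x - y) = 0"
    using seminorm seminorm_nonneg by (blast intro: order_antisym)
  then have "\<not> x - y \<noteq> 0"
    using separated unfolding separated_def by blast
  then show "x = y"
    by simp
qed

lemma linear_le_seminorms_continuous:
  assumes f: "linear f" and F: "finite F" "F \<subseteq> Q" and le: "\<And>v. f v \<le> (\<Sum>q\<in>F. q v)"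
  shows "continuous_map X euclideanreal f"
  unfolding continuous_map_def
proof (intro conjI allI impI)
  fix U :: "real set" assume "openin euclidean U"
  then have U: "open U" by simp
  show "openin X {x \<in> topspace X. f x \<in> U}"
    unfolding openin_X
  proof
    fix x assume "x \<in> {x \<in> topspace X. f x \<in> U}"
    then obtain e where e: "0 < e" "\<And>z. \<bar>z - f x\<bar> < e \<Longrightarrow> z \<in> U"
      using U unfolding open_dist dist_real_def by blast
    \<comment> \<open>The extra 1 covers an empty \<open>F\<close> and makes the total
      \<open>card F * r\<close> strictly smaller than \<open>e\<close>.\<close>
    define r where "r = e / (1 + card F)"
    have "0 < r" using e by (simp add: r_def)
    have "f y \<in> U" if y: "\<forall>q\<in>F. q (y - x) < r" for y
    proof (rule e(2))
      have S: "seminorm (\<lambda>x. \<Sum>q\<in>F. q x)" by (rule seminorm_finite_sum[OF F(2)])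
      have "(\<Sum>q\<in>F. q (y - x)) \<le> card F * r"
        using sum_bounded_above[of F "\<lambda>q. q (y - x)" r] y by (simp add: less_imp_le)
      also have "\<dots> < e"
        using e(1) by (simp add: r_def field_simps)
      finally have "(\<Sum>q\<in>F. q (y - x)) < e" .
      moreover have "\<bar>f y - f x\<bar> \<le> (\<Sum>q\<in>F. q (y - x))"
        using le[of "y - x"] le[of "x - y"] seminorm_diff_commute[OF S, of x y] by (simp add: linear_diff[OF f] abs_le_iff)
      ultimately show "\<bar>f y - f x\<bar> < e" by linarith
    qed
    then show "\<exists>F r. finite F \<and> F \<subseteq> Q \<and> 0 < r \<and> {y. \<forall>q\<in>F. q (y - x) < r} \<subseteq> {x \<in> topspace X. f x \<in> U}"
      using F \<open>0 < r\<close> topspace_X by (intro exI[of _ F] exI[of _ r]) auto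
  qed
qed auto

text \<open>Mazur's theorem in functional form: subgradients separate a point from a sublevel set.\<close>

lemma weakly_closed_sublevel:
  assumes \<phi>: "convex_on UNIV \<phi>" and F: "finite F" "F \<subseteq> Q"
    and lip: "\<And>x v. \<phi> (x + v) \<le> \<phi> x + (\<Sum>q\<in>F. q v)"
  shows "closedin (weak_topology X) {y. \<phi> y \<le> c}"
proof -
  have "openin (weak_topology X) {y. c < \<phi> y}"
  proof (subst openin_subopen, intro ballI)
    fix a assume a: "a \<in> {y. c < \<phi> y}"
    obtain f where f: "linear f" "\<And>v. f v \<le> (\<Sum>q\<in>F. q v)" "\<And>y. \<phi> a + f (y - a) \<le> \<phi> y"
      using convex_on_subgradient[OF \<phi> seminorm_sublinear[OF seminorm_finite_sum[OF F(2)]] lip, where a = a] by blast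
    have "continuous_map (weak_topology X) euclideanreal f"
      by (intro continuous_map_weak_functional f linear_le_seminorms_continuous[OF f(1) F f(2)])
    \<comment> \<open>The threshold is tuned to the subgradient inequality: above it,
      \<open>\<phi> y \<ge> \<phi> a + f y - f a > c\<close>.\<close>
    then have "openin (weak_topology X) {y \<in> topspace (weak_topology X). f y \<in> {f a - (\<phi> a - c)<..}}"
      by (rule openin_continuous_map_preimage) auto
    then have "openin (weak_topology X) {y. f a - (\<phi> a - c) < f y}"
      by simp
    moreover have "{y. f a - (\<phi> a - c) < f y} \<subseteq> {y. c < \<phi> y}"
    proof clarify
      fix y assume "f a - (\<phi> a - c) < f y"
      then show "c < \<phi> y"
        using f(3)[of y] by (simp add: linear_diff[OF f(1)])
    qed
    ultimately show "\<exists>T. openin (weak_topology X) T \<and> a \<in> T \<and> T \<subseteq> {y. c < \<phi> y}"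
      using a by (intro exI[of _ "{y. f a - (\<phi> a - c) < f y}"]) auto
  qed
  moreover have "UNIV - {y. \<phi> y \<le> c} = {y. c < \<phi> y}"
    by auto
  ultimately show ?thesis
    by (simp add: closedin_def)
qed

lemma weakly_closed_ball:
  assumes "q \<in> Q"
  shows "closedin (weak_topology X) {y. q (y - a) \<le> c}"
proof (rule weakly_closed_sublevel[where F = "{q}"])
  show "q (x + v - a) \<le> q (x - a) + (\<Sum>q\<in>{q}. q v)" for x v
    using seminorm_add_le[OF seminorm[OF assms], of "x - a" v] by (simp add: algebra_simps)
qed (use assms seminorm_diff_convex_on[OF seminorm] in auto)

text \<open>Weak lower semicontinuity of the seminorms, pulled back along \<open>u\<close>. With
  \<open>u\<close> a difference of evaluations it turns nonexpansiveness and fixing a point into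
  closed conditions on maps.\<close>

lemma closedin_seminorm_le:
  assumes "q \<in> Q" "continuous_map Y (weak_topology X) u"
  shows "closedin Y {y \<in> topspace Y. q (u y) \<le> c}"
  using closedin_continuous_map_preimage[OF assms(2) weakly_closed_ball[OF assms(1), of 0 c]] by simp

text \<open>A subgradient of \<open>q\<close> at \<open>a\<close> is a norming functional: its
  inequality at the point 0 reads \<open>q a \<le> f a\<close>.\<close>

lemma seminorm_le_functional:
  assumes "q \<in> Q"
  obtains f where "linear f" "continuous_map X euclideanreal f" "\<And>v. \<bar>f v\<bar> \<le> q v" "f a = q a"
proof -
  have S: "seminorm q" using assms seminorm by blast
  have "q (x + v) \<le> q x + q v" for x v
    by (rule seminorm_add_le[OF S])
  then obtain f where f: "linear f" "\<And>v. f v \<le> q v" "\<And>y. q a + f (y - a) \<le> q y"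
    using convex_on_subgradient[OF sublinear_imp_convex_on[OF seminorm_sublinear[OF S]] seminorm_sublinear[OF S], where a = a] by blast
  show thesis
  proof
    show "continuous_map X euclideanreal f"
      using f by (intro linear_le_seminorms_continuous[where F = "{q}"]) (use assms in auto)
    show "\<bar>f v\<bar> \<le> q v" for v
      using f(2)[of v] f(2)[of "- v"] by (simp add: linear_neg[OF f(1)] seminorm_minus[OF S] abs_le_iff)
    show "f a = q a"
      using f(2)[of a] f(3)[of 0] by (simp add: linear_neg[OF f(1)] seminorm_0[OF S])
  qed (fact f(1))
qed

lemma Hausdorff_weak: "Hausdorff_space (weak_topology X)"
  unfolding Hausdorff_space_def
proof (intro allI impI, elim conjE)
  fix x y :: 'a assume "x \<noteq> y"
  then obtain q where q: "q \<in> Q" "0 < q (x - y)"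
    using eq_iff_seminorms[of x y] by (auto simp: not_le)
  obtain f where f: "linear f" "continuous_map X euclideanreal f" "f (x - y) = q (x - y)"
    using seminorm_le_functional[OF q(1), of "x - y"] by blast
  have "f x \<noteq> f y"
    using f(3) q(2) by (simp add: linear_diff[OF f(1)])
  then obtain U V where UV: "open U" "open V" "f x \<in> U" "f y \<in> V" "U \<inter> V = {}"
    using hausdorff[OF \<open>f x \<noteq> f y\<close>] by blast
  have "openin (weak_topology X) {z. f z \<in> A}" if "open A" for A
    using openin_continuous_map_preimage[OF continuous_map_weak_functional[OF f(1,2)], of A] that by simp
  then show "\<exists>U V. openin (weak_topology X) U \<and> openin (weak_topology X) V \<and> x \<in> U \<and> y \<in> V \<and> disjnt U V"
    using UV by (intro exI[of _ "{z. f z \<in> U}"] exI[of _ "{z. f z \<in> V}"]) (auto simp: disjnt_def)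
qed

text \<open>Closedness in \<open>X\<close> itself is what later keeps limits of averaged series
  inside \<open>C\<close>.\<close>

lemma weakly_compact_imp_closedin:
  assumes "compactin (weak_topology X) C"
  shows "closedin (weak_topology X) C" "closedin X C"
proof -
  show C: "closedin (weak_topology X) C"
    using assms Hausdorff_weak by (rule compactin_imp_closedin[rotated])
  have "continuous_map X (weak_topology X) (\<lambda>x. x)"
    by (rule continuous_map_into_weak_topology)
  from closedin_continuous_map_preimage[OF this C] show "closedin X C"
    by (simp add: topspace_X)
qed

end

section \<open>Weakly compact sets\<close>

text \<open>In Zorn's lemma a chain of nonempty closed sets has nonempty intersection by the finite
  intersection property, a finite subchain having its smallest member as intersection.
  \<open>P\<close> is left abstract for two uses: down-closed sets of maps in Bruck's preorder, and
  convex sets invariant under a family.\<close>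

lemma compact_space_minimal_closed:
  assumes "compact_space Y" "topspace Y \<noteq> {}" "P (topspace Y)"
    and Inter: "\<And>\<C>. \<C> \<noteq> {} \<Longrightarrow> (\<And>A. A \<in> \<C> \<Longrightarrow> P A) \<Longrightarrow> P (\<Inter>\<C>)"
  obtains M where "closedin Y M" "M \<noteq> {}" "P M"
    "\<And>A. closedin Y A \<Longrightarrow> A \<noteq> {} \<Longrightarrow> P A \<Longrightarrow> A \<subseteq> M \<Longrightarrow> A = M"
proof -
  define \<A> where "\<A> = {A. closedin Y A \<and> A \<noteq> {} \<and> P A}"
  have "\<exists>M\<in>\<A>. \<forall>A\<in>\<A>. M \<supseteq> A \<longrightarrow> A = M"
  proof (rule predicate_Zorn)
    show "partial_order_on \<A> (relation_of (\<lambda>A B. A \<supseteq> B) \<A>)"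
      by (rule partial_order_on_relation_ofI) auto
    fix \<C> assume \<C>: "\<C> \<in> Chains (relation_of (\<lambda>A B. A \<supseteq> B) \<A>)"
    then have sub: "\<C> \<subseteq> \<A>" and total: "\<And>A B. A \<in> \<C> \<Longrightarrow> B \<in> \<C> \<Longrightarrow> A \<subseteq> B \<or> B \<subseteq> A"
      unfolding Chains_def relation_of_def by auto
    show "\<exists>B\<in>\<A>. \<forall>A\<in>\<C>. A \<supseteq> B"
    proof (cases "\<C> = {}")
      case False
      have "\<Inter>\<F> \<noteq> {}" if \<F>: "finite \<F>" "\<F> \<subseteq> \<C>" for \<F>
      proof (cases "\<F> = {}")
        case False
        have "subset.chain \<A> \<F>"
          unfolding subset_chain_def
        proof (intro conjI ballI)
          show "\<F> \<subseteq> \<A>" by (rule order_trans[OF \<F>(2) sub])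
          show "A \<subseteq> B \<or> B \<subseteq> A" if "A \<in> \<F>" "B \<in> \<F>" for A B
            by (rule total[OF subsetD[OF \<F>(2) that(1)] subsetD[OF \<F>(2) that(2)]])
        qed
        with \<F>(1) False have "\<Inter>\<F> \<in> \<F>"
          by (rule Inter_in_chain)
        then show ?thesis
          using \<F>(2) sub by (auto simp: \<A>_def)
      qed auto
      moreover have \<C>_closed: "closedin Y A" and \<C>_P: "P A" if "A \<in> \<C>" for A
        using subsetD[OF sub that] by (auto simp: \<A>_def)
      ultimately have "\<Inter>\<C> \<noteq> {}"
        using assms(1)[unfolded compact_space_fip, THEN spec[of _ \<C>]] by simp
      moreover have "closedin Y (\<Inter>\<C>)"
        using False \<C>_closed by (rule closedin_Inter)
      moreover have "P (\<Inter>\<C>)"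
        using False \<C>_P by (rule Inter)
      ultimately show ?thesis
        by (intro bexI[of _ "\<Inter>\<C>"]) (auto simp: \<A>_def)
    qed (use assms in \<open>auto simp: \<A>_def\<close>)
  qed
  then show thesis
    using that unfolding \<A>_def by blast
qed

context separated_lcs
begin

lemma closedin_seminorm_family:
  assumes "\<And>i. i \<in> I \<Longrightarrow> q i \<in> Q" "\<And>i. i \<in> I \<Longrightarrow> continuous_map Y (weak_topology X) (u i)"
  shows "closedin Y {y \<in> topspace Y. \<forall>i\<in>I. q i (u i y) \<le> c i}"
proof (cases "I = {}")
  case False
  have "{y \<in> topspace Y. \<forall>i\<in>I. q i (u i y) \<le> c i} = (\<Inter>i\<in>I. {y \<in> topspace Y. q i (u i y) \<le> c i})"
    using False by blast
  moreover have "closedin Y (\<Inter>i\<in>I. {y \<in> topspace Y. q i (u i y) \<le> c i})"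
    using False assms by (intro closedin_INT closedin_seminorm_le)
  ultimately show ?thesis by simp
qed simp

text \<open>Gliding hump: if \<open>q\<close> is unbounded on \<open>C\<close>, a series of functionals dominated by \<open>q\<close> yields
  a continuous functional that is unbounded on \<open>C\<close>.\<close>

lemma weakly_compact_seminorm_bounded:
  assumes C: "compactin (weak_topology X) C" and q: "q \<in> Q"
  obtains B where "\<And>x. x \<in> C \<Longrightarrow> q x \<le> B"
proof -
  have functional_bounded: "\<exists>M. \<forall>x\<in>C. \<bar>f x\<bar> \<le> M" if "linear f" "continuous_map X euclideanreal f" for f
  proof -
    have "compact (f ` C)"
      using image_compactin[OF C continuous_map_weak_functional[OF that]] by simp
    then show ?thesis
      by (auto dest!: compact_imp_bounded simp: bounded_real)
  qed
  have "\<exists>f. linear f \<and> continuous_map X euclideanreal f \<and> (\<forall>v. \<bar>f v\<bar> \<le> q v) \<and> f a = q a" for a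
    using seminorm_le_functional[OF q, of a] by blast
  then obtain \<Phi> where \<Phi>: "\<And>a. linear (\<Phi> a)" "\<And>a. continuous_map X euclideanreal (\<Phi> a)"
      "\<And>a v. \<bar>\<Phi> a v\<bar> \<le> q v" "\<And>a. \<Phi> a a = q a"
    by metis
  obtain M where M: "\<And>a x. x \<in> C \<Longrightarrow> \<bar>\<Phi> a x\<bar> \<le> M a"
    using functional_bounded[OF \<Phi>(1,2)] by metis
  show thesis
  proof (rule ccontr)
    assume "\<not> thesis"
    then have "\<exists>x\<in>C. b < q x" for b
      using that by (meson not_le)
    then obtain pt where pt: "\<And>b. pt b \<in> C" "\<And>b. b < q (pt b)"
      by metis
    \<comment> \<open>With ratio 1/4 the weights after index \<open>n\<close> add up to
      \<open>c n / 3\<close>, so the tail of the series cancels at most a third of the main term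
      \<open>c n * q (x n)\<close>.\<close>
    define c :: "nat \<Rightarrow> real" where "c k = (1/4) ^ Suc k" for k
    have c_pos: "0 < c k" for k by (simp add: c_def)
    have c_sums: "(\<lambda>k. c (k + n)) sums ((1/4) ^ n / 3)" for n
    proof -
      have "(\<lambda>k. (1/4) ^ Suc n * (1/4) ^ k) sums ((1/4) ^ Suc n * (1 / (1 - 1/4 :: real)))"
        by (intro sums_mult geometric_sums) simp
      then show ?thesis
        by (simp add: c_def power_add mult_ac)
    qed
    \<comment> \<open>Points and bounds are built together: \<open>b\<close> bounds the contribution
      of all earlier terms on the whole of \<open>C\<close>, and the new point makes the main term
      exceed \<open>2 * (n + b)\<close>. After losing a third of it to the tail and \<open>b\<close>
      to the earlier terms, at least \<open>n\<close> remains.\<close>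
    define next_pt where "next_pt n b = pt (2 / c n * (real n + b))" for n b
    define B where "B = rec_nat 0 (\<lambda>n b. b + c n * M (next_pt n b))"
    define x where "x n = next_pt n (B n)" for n
    have xC: "x n \<in> C" for n
      using pt by (simp add: x_def next_pt_def)
    have "B n = (\<Sum>k<n. c k * M (x k))" for n
      by (induction n) (simp_all add: B_def x_def)
    then have B: "(\<Sum>k<n. c k * M (x k)) = B n" for n
      by simp
    have q_x: "2 * (real n + B n) < c n * q (x n)" for n
      using pt(2)[of "2 / c n * (real n + B n)"] c_pos[of n] by (simp add: x_def next_pt_def field_simps)
    define f where "f v = (\<Sum>k. c k * \<Phi> (x k) v)" for v
    have abs_le: "\<bar>c k * \<Phi> (x k) v\<bar> \<le> c k * q v" for k v
      using \<Phi>(3)[of "x k" v] c_pos[of k] by (simp add: abs_mult)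
    have summable_c: "summable (\<lambda>k. c (k + n) * q v)" for n v
      using c_sums[of n] by (intro summable_mult2) (rule sums_summable)
    have summable: "summable (\<lambda>k. c (k + n) * \<Phi> (x (k + n)) v)" for n v
      using abs_le by (intro summable_comparison_test[OF _ summable_c[of n v]]) auto
    have tail: "\<bar>\<Sum>k. c (k + n) * \<Phi> (x (k + n)) v\<bar> \<le> (1/4) ^ n / 3 * q v" for n v
    proof -
      have "\<bar>\<Sum>k. c (k + n) * \<Phi> (x (k + n)) v\<bar> \<le> (\<Sum>k. c (k + n) * q v)"
        using norm_suminf_le[OF _ summable_c[of n v], of "\<lambda>k. c (k + n) * \<Phi> (x (k + n)) v"] abs_le by simp
      also have "\<dots> = (1/4) ^ n / 3 * q v"
        using sums_mult2[OF c_sums[of n], of "q v"] by (rule sums_unique[symmetric])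
      finally show ?thesis .
    qed
    have lin: "linear f"
    proof (rule linearI)
      show "f (u + v) = f u + f v" for u v
        unfolding f_def using summable[of 0]
        by (subst suminf_add) (simp_all add: linear_add[OF \<Phi>(1)] distrib_left)
      show "f (r *\<^sub>R v) = r *\<^sub>R f v" for r v
        unfolding f_def using summable[of 0]
        by (simp add: linear_scale[OF \<Phi>(1)] mult.left_commute suminf_mult)
    qed
    have "f v \<le> (\<Sum>q\<in>{q}. q v)" for v
      using tail[of 0 v] seminorm_nonneg[OF seminorm[OF q], of v] by (simp add: f_def)
    then have "continuous_map X euclideanreal f"
      using q by (intro linear_le_seminorms_continuous[OF lin, of "{q}"]) auto
    from functional_bounded[OF lin this] obtain K where K: "\<And>x. x \<in> C \<Longrightarrow> \<bar>f x\<bar> \<le> K"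
      by blast
    have "real n \<le> K" for n
    proof -
      define H where "H = (\<Sum>k<n. c k * \<Phi> (x k) (x n))"
      define R where "R = (\<Sum>k. c (k + Suc n) * \<Phi> (x (k + Suc n)) (x n))"
      have "f (x n) = R + H + c n * q (x n)"
        unfolding f_def R_def H_def
        using suminf_split_initial_segment[OF summable[of 0, simplified], of "x n" "Suc n"]
        by (simp add: \<Phi>(4))
      moreover have "\<bar>R\<bar> \<le> c n * q (x n) / 3"
        using tail[of "Suc n" "x n"] unfolding R_def c_def by (simp only: times_divide_eq_left)
      moreover have "\<bar>H\<bar> \<le> B n"
        unfolding B[symmetric] H_def using M[OF xC[of n]] c_pos
        by (intro order_trans[OF sum_abs] sum_mono) (simp add: abs_mult less_imp_le)
      moreover from this have "0 \<le> B n"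
        by (rule order_trans[OF abs_ge_zero])
      ultimately have "real n \<le> f (x n)"
        using q_x[of n] of_nat_0_le_iff[of n, where ?'a = real] by argo
      then show ?thesis
        using K[OF xC[of n]] by linarith
    qed
    then show False
      by (meson not_le reals_Archimedean2)
  qed
qed

end

section \<open>Bruck's retraction theorem\<close>

lemma nonexpansive_onD:
  assumes "nonexpansive_on Q C T"
  shows "x \<in> C \<Longrightarrow> T x \<in> C" "x \<in> C \<Longrightarrow> y \<in> C \<Longrightarrow> q \<in> Q \<Longrightarrow> q (T x - T y) \<le> q (x - y)"
  using assms unfolding nonexpansive_on_def by auto

lemma nonexpansive_on_compose:
  assumes "nonexpansive_on Q C S" "nonexpansive_on Q C T"
  shows "nonexpansive_on Q C (\<lambda>x. S (T x))"
  unfolding nonexpansive_on_def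
proof (intro conjI ballI Pi_I)
  fix x y q assume "x \<in> C" "y \<in> C" "q \<in> Q"
  then show "q (S (T x) - S (T y)) \<le> q (x - y)"
    by (meson assms nonexpansive_onD order_trans)
qed (use assms nonexpansive_onD in blast)

lemma nonexpansive_on_cong:
  assumes "nonexpansive_on Q C S" "\<And>x. x \<in> C \<Longrightarrow> S x = T x"
  shows "nonexpansive_on Q C T"
  using assms unfolding nonexpansive_on_def by (simp add: Pi_def)

context separated_lcs
begin

text \<open>The maps are extensional on \<open>C\<close> so that they are points of the product
  space \<open>pointwise_weak_topology C\<close>, which is compact by Tychonoff's theorem when
  \<open>C\<close> is weakly compact. This explains the uses of \<open>restrict\<close>
  below.\<close>

definition nonexpansive_fixing :: "'a set \<Rightarrow> 'a set \<Rightarrow> ('a \<Rightarrow> 'a) set" where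
  "nonexpansive_fixing C F = {f \<in> C \<rightarrow>\<^sub>E C. nonexpansive_on Q C f \<and> (\<forall>z\<in>F. f z = z)}"

definition pointwise_weak_topology :: "'a set \<Rightarrow> ('a \<Rightarrow> 'a) topology" where
  "pointwise_weak_topology C = product_topology (\<lambda>_. subtopology (weak_topology X) C) C"

lemma topspace_pointwise_weak: "topspace (pointwise_weak_topology C) = C \<rightarrow>\<^sub>E C"
  by (simp add: pointwise_weak_topology_def)

lemma continuous_map_evaluation:
  assumes "x \<in> C"
  shows "continuous_map (pointwise_weak_topology C) (weak_topology X) (\<lambda>f. f x)"
  unfolding pointwise_weak_topology_def
  by (rule continuous_map_into_fulltopology[OF continuous_map_product_projection[OF assms]])

text \<open>The bound \<open>d\<close> is arbitrary because it is used both as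
  \<open>q (x - y)\<close>, for nonexpansiveness, and as \<open>q (f x - f y)\<close>, for
  domination by another map.\<close>

lemma closedin_dominated:
  "closedin (pointwise_weak_topology C) {f \<in> C \<rightarrow>\<^sub>E C. \<forall>x\<in>C. \<forall>y\<in>C. \<forall>q\<in>Q. q (f x - f y) \<le> d q x y}"
proof -
  have "closedin (pointwise_weak_topology C)
      {f \<in> topspace (pointwise_weak_topology C). \<forall>(x, y, q)\<in>C \<times> C \<times> Q. q (f x - f y) \<le> d q x y}"
    using closedin_seminorm_family[of "C \<times> C \<times> Q" "\<lambda>(x, y, q). q" "pointwise_weak_topology C"
        "\<lambda>(x, y, q) f. f x - f y" "\<lambda>(x, y, q). d q x y"]
    by (simp add: case_prod_unfold continuous_map_weak_diff continuous_map_evaluation mem_Times_iff)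
  then show ?thesis
    by (simp add: topspace_pointwise_weak)
qed

lemma closedin_nonexpansive_fixing:
  assumes "F \<subseteq> C"
  shows "closedin (pointwise_weak_topology C) (nonexpansive_fixing C F)"
proof -
  have "closedin (pointwise_weak_topology C)
      {f \<in> topspace (pointwise_weak_topology C). \<forall>(z, q)\<in>F \<times> Q. q (f z - z) \<le> 0}"
    using assms closedin_seminorm_family[of "F \<times> Q" "\<lambda>(z, q). q" "pointwise_weak_topology C"
        "\<lambda>(z, q) f. f z - z" "\<lambda>_. 0"]
    by (simp add: case_prod_unfold continuous_map_weak_diff continuous_map_evaluation mem_Times_iff subset_iff)
  then have "closedin (pointwise_weak_topology C) {f \<in> C \<rightarrow>\<^sub>E C. \<forall>z\<in>F. \<forall>q\<in>Q. q (f z - z) \<le> 0}"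
    by (simp add: topspace_pointwise_weak)
  from closedin_Int[OF closedin_dominated[of C "\<lambda>q x y. q (x - y)"] this]
  have "closedin (pointwise_weak_topology C)
    ({f \<in> C \<rightarrow>\<^sub>E C. \<forall>x\<in>C. \<forall>y\<in>C. \<forall>q\<in>Q. q (f x - f y) \<le> q (x - y)} \<inter> {f \<in> C \<rightarrow>\<^sub>E C. \<forall>z\<in>F. f z = z})"
    by (simp add: eq_iff_seminorms)
  moreover have "nonexpansive_fixing C F =
    {f \<in> C \<rightarrow>\<^sub>E C. \<forall>x\<in>C. \<forall>y\<in>C. \<forall>q\<in>Q. q (f x - f y) \<le> q (x - y)} \<inter> {f \<in> C \<rightarrow>\<^sub>E C. \<forall>z\<in>F. f z = z}"
    unfolding nonexpansive_fixing_def nonexpansive_on_def by (auto simp: PiE_iff)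
  ultimately show ?thesis
    by simp
qed

lemma restrict_nonexpansive_fixing:
  assumes "nonexpansive_on Q C T" "\<And>z. z \<in> F \<Longrightarrow> T z = z" "F \<subseteq> C"
  shows "restrict T C \<in> nonexpansive_fixing C F"
proof -
  have "nonexpansive_on Q C (restrict T C)"
    by (rule nonexpansive_on_cong[OF assms(1)]) simp
  moreover have "restrict T C \<in> C \<rightarrow>\<^sub>E C"
    using nonexpansive_onD(1)[OF assms(1)] by simp
  ultimately show ?thesis
    unfolding nonexpansive_fixing_def using assms(2,3) by (simp add: subset_iff)
qed

lemma nonexpansive_fixing_compose:
  assumes "f \<in> nonexpansive_fixing C F" "nonexpansive_on Q C T" "\<And>z. z \<in> F \<Longrightarrow> T z = z" "F \<subseteq> C"
  shows "restrict (\<lambda>x. T (f x)) C \<in> nonexpansive_fixing C F" "restrict (\<lambda>x. f (T x)) C \<in> nonexpansive_fixing C F"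
proof -
  have f: "nonexpansive_on Q C f" "\<And>z. z \<in> F \<Longrightarrow> f z = z"
    using assms(1) by (auto simp: nonexpansive_fixing_def)
  show "restrict (\<lambda>x. T (f x)) C \<in> nonexpansive_fixing C F"
    by (intro restrict_nonexpansive_fixing nonexpansive_on_compose[OF assms(2) f(1)] assms(4))
      (simp add: f(2) assms(3))
  show "restrict (\<lambda>x. f (T x)) C \<in> nonexpansive_fixing C F"
    by (intro restrict_nonexpansive_fixing nonexpansive_on_compose[OF f(1) assms(2)] assms(4))
      (simp add: f(2) assms(3))
qed

text \<open>Pointwise convex combinations of such maps are again such maps. With compactness of the
  space of maps, this makes the orbit of a point a set to which the weakly fixed point property
  applies.\<close>

lemma nonexpansive_fixing_orbit_convex:
  assumes "convex C" "F \<subseteq> C" "z \<in> C"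
  shows "convex ((\<lambda>f. f z) ` nonexpansive_fixing C F)"
proof (rule convexI)
  fix a b and u v :: real
  assume "a \<in> (\<lambda>f. f z) ` nonexpansive_fixing C F" "b \<in> (\<lambda>f. f z) ` nonexpansive_fixing C F"
    and uv: "0 \<le> u" "0 \<le> v" "u + v = 1"
  then obtain f g where fg: "f \<in> nonexpansive_fixing C F" "g \<in> nonexpansive_fixing C F" and ab: "a = f z" "b = g z"
    by blast
  define h where "h = restrict (\<lambda>x. u *\<^sub>R f x + v *\<^sub>R g x) C"
  have f: "nonexpansive_on Q C f" "\<And>z. z \<in> F \<Longrightarrow> f z = z"
    and g: "nonexpansive_on Q C g" "\<And>z. z \<in> F \<Longrightarrow> g z = z"
    using fg by (auto simp: nonexpansive_fixing_def)
  have "h \<in> C \<rightarrow>\<^sub>E C"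
    using nonexpansive_onD(1)[OF f(1)] nonexpansive_onD(1)[OF g(1)] convexD[OF assms(1)] uv
    by (auto simp: h_def)
  moreover have "q (h x - h y) \<le> q (x - y)" if "x \<in> C" "y \<in> C" "q \<in> Q" for x y q
  proof -
    note S = seminorm[OF that(3)]
    have "h x - h y = u *\<^sub>R (f x - f y) + v *\<^sub>R (g x - g y)"
      using that by (simp add: h_def algebra_simps)
    then have "q (h x - h y) \<le> u * q (f x - f y) + v * q (g x - g y)"
      using seminorm_add_le[OF S, of "u *\<^sub>R (f x - f y)" "v *\<^sub>R (g x - g y)"] uv
      by (simp add: seminorm_scaleR[OF S])
    also have "\<dots> \<le> u * q (x - y) + v * q (x - y)"
      using nonexpansive_onD(2)[OF f(1) that] nonexpansive_onD(2)[OF g(1) that] uv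
      by (intro add_mono mult_left_mono)
    also have "\<dots> = q (x - y)"
      using uv by (simp flip: distrib_right)
    finally show ?thesis .
  qed
  moreover have "h z = z" if "z \<in> F" for z
    using that f(2) g(2) assms(2) uv by (auto simp: h_def simp flip: scaleR_add_left)
  ultimately have "h \<in> nonexpansive_fixing C F"
    by (auto simp: nonexpansive_fixing_def nonexpansive_on_def PiE_iff)
  then show "u *\<^sub>R a + v *\<^sub>R b \<in> (\<lambda>f. f z) ` nonexpansive_fixing C F"
    using assms(3) by (intro image_eqI[of _ _ h]) (auto simp: h_def ab)
qed

text \<open>Bruck's argument.  Take \<open>r\<close> minimal, in the preorder comparing all \<open>q (f x - f y)\<close>, among the
  nonexpansive maps that are the identity on the fixed points of \<open>U\<close>. Every such \<open>f\<close> then preserves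
  the distances between points of the range of \<open>r\<close>; the orbit of \<open>r x\<close> under these \<open>f\<close> contains a
  fixed point \<open>w\<close> of \<open>U\<close>, and comparing \<open>r x\<close> with \<open>r w = w\<close> shows \<open>r x = w\<close>.\<close>

lemma nonexpansive_retraction_onto_fixed_points:
  assumes fpp: "weakly_fpp X Q"
    and C: "compactin (weak_topology X) C" "convex C"
    and U: "nonexpansive_on Q C U"
  obtains r where "nonexpansive_on Q C r" "\<And>x. x \<in> C \<Longrightarrow> U (r x) = r x"
    "\<And>x. x \<in> C \<Longrightarrow> U x = x \<Longrightarrow> r x = x"
proof -
  let ?Y = "pointwise_weak_topology C"
  define F where "F = {z \<in> C. U z = z}"
  define N where "N = nonexpansive_fixing C F"
  define below where "below f = {g \<in> N. \<forall>x\<in>C. \<forall>y\<in>C. \<forall>q\<in>Q. q (g x - g y) \<le> q (f x - f y)}" for f :: "'a \<Rightarrow> 'a"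
  have FC: "F \<subseteq> C" and UF: "\<And>z. z \<in> F \<Longrightarrow> U z = z"
    by (auto simp: F_def)
  have "compact_space ?Y"
    unfolding pointwise_weak_topology_def using C(1) by (simp add: compact_space_product_topology compact_space_subtopology)
  moreover have closed_N: "closedin ?Y N"
    unfolding N_def by (rule closedin_nonexpansive_fixing[OF FC])
  ultimately have compact_N: "compactin ?Y N"
    by (rule closedin_compact_space)
  have N_top: "topspace (subtopology ?Y N) = N"
    using closedin_subset[OF closed_N] by auto
  have closed_below: "closedin (subtopology ?Y N) (below f)" for f
  proof -
    have "below f = N \<inter> {g \<in> C \<rightarrow>\<^sub>E C. \<forall>x\<in>C. \<forall>y\<in>C. \<forall>q\<in>Q. q (g x - g y) \<le> q (f x - f y)}"
      by (auto simp: below_def N_def nonexpansive_fixing_def)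
    then show ?thesis
      by (simp only: closedin_subtopology_Int_closed[OF closedin_dominated])
  qed
  \<comment> \<open>A minimal map is extracted from a minimal closed down-closed set: for each
    \<open>h\<close> in \<open>M\<close> the set \<open>below h\<close> is closed, nonempty and
    down-closed, hence all of \<open>M\<close>.\<close>
  obtain M where M: "closedin (subtopology ?Y N) M" "M \<noteq> {}" "\<forall>f\<in>M. below f \<subseteq> M"
    and min: "\<And>A. closedin (subtopology ?Y N) A \<Longrightarrow> A \<noteq> {} \<Longrightarrow> \<forall>f\<in>A. below f \<subseteq> A \<Longrightarrow> A \<subseteq> M \<Longrightarrow> A = M"
  proof (rule compact_space_minimal_closed[where Y = "subtopology ?Y N" and P = "\<lambda>A. \<forall>f\<in>A. below f \<subseteq> A"])
    show "compact_space (subtopology ?Y N)"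
      by (rule compact_space_subtopology[OF compact_N])
    have "restrict (\<lambda>x. x) C \<in> N"
      unfolding N_def by (rule restrict_nonexpansive_fixing) (use FC in \<open>auto simp: nonexpansive_on_def\<close>)
    then show "topspace (subtopology ?Y N) \<noteq> {}"
      unfolding N_top by blast
    show "\<forall>f\<in>topspace (subtopology ?Y N). below f \<subseteq> topspace (subtopology ?Y N)"
      unfolding N_top by (auto simp: below_def)
  qed blast+
  obtain r where "r \<in> M" using M(2) by blast
  then have rN: "r \<in> N"
    using closedin_subset[OF M(1)] N_top by blast
  then have r: "nonexpansive_on Q C r" "\<And>z. z \<in> F \<Longrightarrow> r z = z"
    by (auto simp: N_def nonexpansive_fixing_def)
  have r_min: "r \<in> below h" if "h \<in> below r" for h
  proof -
    have hM: "h \<in> M" using that M(3) \<open>r \<in> M\<close> by blast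
    have "below h = M"
    proof (rule min[OF closed_below])
      show "below h \<noteq> {}" using that by (auto simp: below_def)
      show "below h \<subseteq> M" using M(3) hM by blast
      show "\<forall>f\<in>below h. below f \<subseteq> below h"
        unfolding below_def by (blast intro: order_trans)
    qed
    then show ?thesis using \<open>r \<in> M\<close> by simp
  qed
  have retract: "U (r x) = r x" if "x \<in> C" for x
  proof -
    \<comment> \<open>\<open>U\<close> maps this orbit into itself, since composing with
      \<open>U\<close> still fixes every point of \<open>F\<close>.\<close>
    define K where "K = (\<lambda>f. f (r x)) ` N"
    have rx: "r x \<in> C" using r(1) that by (rule nonexpansive_onD)
    have KC: "K \<subseteq> C"
      using rx by (auto simp: K_def N_def nonexpansive_fixing_def PiE_iff)
    have "K \<noteq> {}"
      using rN by (auto simp: K_def)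
    moreover have "compactin (weak_topology X) K"
      unfolding K_def by (rule image_compactin[OF compact_N continuous_map_evaluation[OF rx]])
    moreover have "convex K"
      unfolding K_def N_def by (rule nonexpansive_fixing_orbit_convex[OF C(2) FC rx])
    moreover have "U a \<in> K" if "a \<in> K" for a
    proof -
      from that obtain f where f: "f \<in> N" "a = f (r x)"
        by (auto simp: K_def)
      have "restrict (\<lambda>x. U (f x)) C \<in> N"
        using nonexpansive_fixing_compose(1)[OF f(1)[unfolded N_def] U UF FC] unfolding N_def .
      then show ?thesis
        unfolding K_def f(2) using rx by (intro image_eqI[of _ _ "restrict (\<lambda>x. U (f x)) C"]) auto
    qed
    then have "nonexpansive_on Q K U"
      using U KC unfolding nonexpansive_on_def by blast
    ultimately obtain w where "w \<in> K" "U w = w"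
      using fpp[unfolded weakly_fpp_def, rule_format, of K U] by blast
    then have wF: "w \<in> F"
      using KC by (auto simp: F_def)
    obtain f where f: "f \<in> N" "w = f (r x)"
      using \<open>w \<in> K\<close> by (auto simp: K_def)
    have fw: "f w = w"
      using f(1) wF by (auto simp: N_def nonexpansive_fixing_def)
    have wC: "w \<in> C" using wF FC by blast
    \<comment> \<open>\<open>h\<close> lies below \<open>r\<close> because \<open>f\<close> is
      nonexpansive, and it sends both \<open>x\<close> and \<open>w\<close> to \<open>w\<close>.
      Minimality of \<open>r\<close> therefore forces \<open>r x\<close> and \<open>r w\<close> to
      have distance 0.\<close>
    define h where "h = restrict (\<lambda>x. f (r x)) C"
    have "h \<in> N"
      using nonexpansive_fixing_compose(2)[OF f(1)[unfolded N_def] r FC] unfolding N_def h_def .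
    moreover have "nonexpansive_on Q C f"
      using f(1) by (simp add: N_def nonexpansive_fixing_def)
    then have "q (h a - h b) \<le> q (r a - r b)" if "a \<in> C" "b \<in> C" "q \<in> Q" for a b q
      using that nonexpansive_onD(1)[OF r(1)] by (simp add: h_def nonexpansive_onD(2))
    ultimately have "h \<in> below r"
      by (auto simp: below_def)
    from r_min[OF this] have le: "q (r x - r w) \<le> q (h x - h w)" if "q \<in> Q" for q
      using \<open>x \<in> C\<close> wC that by (auto simp: below_def)
    have "q (r x - w) \<le> 0" if "q \<in> Q" for q
      using le[OF that] \<open>x \<in> C\<close> wC f(2) fw r(2)[OF wF] seminorm_0[OF seminorm[OF that]] by (simp add: h_def)
    then have "r x = w"
      by (simp add: eq_iff_seminorms)
    then show ?thesis
      using \<open>U w = w\<close> by simp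
  qed
  show thesis
    using that[OF r(1) retract] r(2) by (auto simp: F_def)
qed

end

section \<open>Countable commuting families\<close>

lemma convex_on_sublevel:
  assumes "convex_on UNIV f"
  shows "convex {x. f x \<le> c}"
proof (rule convexI)
  fix x y and u v :: real
  assume xy: "x \<in> {x. f x \<le> c}" "y \<in> {x. f x \<le> c}" and uv: "0 \<le> u" "0 \<le> v" "u + v = 1"
  then have "f (u *\<^sub>R x + v *\<^sub>R y) \<le> u * f x + v * f y"
    using assms unfolding convex_on_def by blast
  also have "\<dots> \<le> c"
    using xy uv by (intro convex_bound_le) auto
  finally show "u *\<^sub>R x + v *\<^sub>R y \<in> {x. f x \<le> c}"
    by simp
qed

text \<open>Unfolded, this is the sum of \<open>(1/2) ^ (j + 1) *\<^sub>R y j\<close> over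
  \<open>j < n\<close> plus \<open>(1/2) ^ n *\<^sub>R x\<close>. Giving the leftover weight to
  \<open>x\<close> makes every partial sum a genuine convex combination.\<close>

primrec dyadic_sum :: "(nat \<Rightarrow> 'a::real_vector) \<Rightarrow> nat \<Rightarrow> 'a \<Rightarrow> 'a" where
  "dyadic_sum y 0 x = x"
| "dyadic_sum y (Suc n) x = dyadic_sum y n ((1/2) *\<^sub>R y n + (1/2) *\<^sub>R x)"

lemma dyadic_sum_diff: "dyadic_sum y n x - dyadic_sum y n z = (1/2) ^ n *\<^sub>R (x - z)"
  by (induction n arbitrary: x z) (simp_all flip: scaleR_diff_right)

text \<open>The terms from index \<open>n\<close> on collapse, together with \<open>x\<close>, into
  a single point \<open>z\<close> of \<open>K\<close> carrying the leftover weight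
  \<open>(1/2) ^ n\<close>.\<close>

lemma dyadic_sum_split:
  assumes "convex K" "\<And>j. n \<le> j \<Longrightarrow> y j \<in> K" "x \<in> K" "n \<le> m"
  shows "\<exists>z\<in>K. dyadic_sum y m x = dyadic_sum y n z"
  using assms(4,3)
proof (induction m arbitrary: x rule: dec_induct)
  case (step m)
  have "(1/2) *\<^sub>R y m + (1/2) *\<^sub>R x \<in> K"
    using step assms(2) by (intro convexD[OF assms(1)]) auto
  from step.IH[OF this] show ?case
    by simp
qed auto

lemma dyadic_sum_mem:
  assumes "convex K" "\<And>j. y j \<in> K" "x \<in> K"
  shows "dyadic_sum y m x \<in> K"
  using dyadic_sum_split[OF assms(1) _ assms(3), of 0 y m] assms(2) by auto

lemma seminorm_half_sum:
  assumes "seminorm q" "q a \<le> A" "q b \<le> B"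
  shows "q ((1/2) *\<^sub>R a + (1/2) *\<^sub>R b) \<le> (A + B) / 2"
  using seminorm_add_le[OF assms(1), of "(1/2) *\<^sub>R a" "(1/2) *\<^sub>R b"] assms(2,3)
  by (simp add: seminorm_scaleR[OF assms(1)])

lemma dyadic_sum_nonexpansive:
  assumes "seminorm q" "\<And>j. q (y j - y' j) \<le> d" "q (x - x') \<le> d"
  shows "q (dyadic_sum y n x - dyadic_sum y' n x') \<le> d"
  using assms(3)
proof (induction n arbitrary: x x')
  case (Suc n)
  have "(1/2) *\<^sub>R y n + (1/2) *\<^sub>R x - ((1/2) *\<^sub>R y' n + (1/2) *\<^sub>R x') = (1/2) *\<^sub>R (y n - y' n) + (1/2) *\<^sub>R (x - x')"
    by (simp add: algebra_simps)
  then show ?case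
    using Suc.IH[of "(1/2) *\<^sub>R y n + (1/2) *\<^sub>R x" "(1/2) *\<^sub>R y' n + (1/2) *\<^sub>R x'"]
      seminorm_half_sum[OF assms(1) assms(2)[of n] Suc.prems] by simp
qed simp

text \<open>The factor \<open>1 - (1/2) ^ n\<close> is the total weight of the first
  \<open>n\<close> terms.\<close>

lemma dyadic_sum_dist_le:
  assumes "seminorm q" "\<And>j. j < n \<Longrightarrow> q (y j - p) \<le> b"
  shows "q (dyadic_sum y n z - p) \<le> (1 - (1/2) ^ n) * b + (1/2) ^ n * q (z - p)"
  using assms(2)
proof (induction n arbitrary: z)
  case (Suc n)
  have "(1/2) *\<^sub>R y n + (1/2) *\<^sub>R z - p = (1/2) *\<^sub>R (y n - p) + (1/2) *\<^sub>R (z - p)"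
    by (simp add: algebra_simps flip: scaleR_add_left)
  then have "q ((1/2) *\<^sub>R y n + (1/2) *\<^sub>R z - p) \<le> (b + q (z - p)) / 2"
    using seminorm_half_sum[OF assms(1) Suc.prems[of n] order_refl[of "q (z - p)"]] by simp
  then have "(1/2) ^ n * q ((1/2) *\<^sub>R y n + (1/2) *\<^sub>R z - p) \<le> (1/2) ^ n * ((b + q (z - p)) / 2)"
    by (intro mult_left_mono) auto
  with Suc.IH[of "(1/2) *\<^sub>R y n + (1/2) *\<^sub>R z"] Suc.prems show ?case
    by (fastforce simp: algebra_simps)
qed simp

context separated_lcs
begin

lemma openin_seminorm_ball:
  assumes "q \<in> Q"
  shows "openin X {y. q (y - a) < e}"
  unfolding openin_X
proof
  fix x assume x: "x \<in> {y. q (y - a) < e}"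
  have "q (y - a) < e" if "q (y - x) < e - q (x - a)" for y
    using seminorm_diff_triangle[OF seminorm[OF assms], of y a x] that by linarith
  with x assms show "\<exists>F r. finite F \<and> F \<subseteq> Q \<and> 0 < r \<and> {y. \<forall>q\<in>F. q (y - x) < r} \<subseteq> {y. q (y - a) < e}"
    by (intro exI[of _ "{q}"] exI[of _ "e - q (x - a)"]) auto
qed

lemma limitin_imp_seminorm_tendsto:
  assumes "limitin X \<sigma> l sequentially" "q \<in> Q"
  shows "(\<lambda>n. q (\<sigma> n - l)) \<longlonglongrightarrow> 0"
proof (rule tendstoI)
  fix e :: real assume "0 < e"
  have "l \<in> {y. q (y - l) < e}"
    using \<open>0 < e\<close> seminorm_0[OF seminorm[OF assms(2)]] by simp
  with assms openin_seminorm_ball[OF assms(2), of l e] have "\<forall>\<^sub>F n in sequentially. \<sigma> n \<in> {y. q (y - l) < e}"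
    unfolding limitin_def by blast
  then show "\<forall>\<^sub>F n in sequentially. dist (q (\<sigma> n - l)) 0 < e"
    by eventually_elim (simp add: seminorm_nonneg[OF seminorm[OF assms(2)]])
qed

lemma weakly_compact_seminorm_diameter:
  assumes "compactin (weak_topology X) C" "q \<in> Q"
  obtains D where "\<And>x y. x \<in> C \<Longrightarrow> y \<in> C \<Longrightarrow> q (x - y) \<le> D"
proof -
  obtain B where B: "\<And>x. x \<in> C \<Longrightarrow> q x \<le> B"
    using weakly_compact_seminorm_bounded[OF assms] by blast
  have "q (x - y) \<le> B + B" if "x \<in> C" "y \<in> C" for x y
    using seminorm_add_le[OF seminorm[OF assms(2)], of x "- y"] seminorm_minus[OF seminorm[OF assms(2)], of y]
      B[OF that(1)] B[OF that(2)] by simp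
  then show thesis by (rule that)
qed

text \<open>Two partial sums beyond \<open>N\<close> differ by \<open>(1/2) ^ N\<close> times a
  difference of points of \<open>C\<close>, and \<open>C\<close> has finite diameter for each
  seminorm; so the sums are Cauchy.\<close>

lemma dyadic_sum_limit:
  assumes complete: "sequentially_complete X"
    and C: "compactin (weak_topology X) C" "convex C"
    and y: "\<And>j. y j \<in> C" and x: "x \<in> C"
  shows "\<exists>l\<in>C. \<forall>q\<in>Q. (\<lambda>m. q (dyadic_sum y m x - l)) \<longlonglongrightarrow> 0"
proof -
  have "\<exists>N. \<forall>m\<ge>N. \<forall>n\<ge>N. dyadic_sum y m x - dyadic_sum y n x \<in> U" if U: "openin X U" "0 \<in> U" for U
  proof -
    obtain F r where F: "finite F" "F \<subseteq> Q" "0 < r" "{y. \<forall>q\<in>F. q (y - 0) < r} \<subseteq> U"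
      using bspec[OF U(1)[unfolded openin_X] U(2)] by (elim exE conjE) (rule that)
    have "\<forall>\<^sub>F N in sequentially. \<forall>x\<in>C. \<forall>z\<in>C. (1/2) ^ N * q (x - z) < r" if "q \<in> F" for q
    proof -
      obtain D where D: "\<And>x y. x \<in> C \<Longrightarrow> y \<in> C \<Longrightarrow> q (x - y) \<le> D"
        using weakly_compact_seminorm_diameter[OF C(1)] F(2) \<open>q \<in> F\<close> by blast
      have "(\<lambda>N. (1/2) ^ N * D) \<longlonglongrightarrow> 0"
        by (rule tendsto_eq_rhs[OF tendsto_mult_right[OF LIMSEQ_power_zero]]) auto
      from order_tendstoD(2)[OF this F(3)] show ?thesis
      proof eventually_elim
        case (elim N)
        show ?case
        proof (intro ballI)
          fix x z assume "x \<in> C" "z \<in> C"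
          then have "(1/2) ^ N * q (x - z) \<le> (1/2) ^ N * D"
            using D by (intro mult_left_mono) auto
          with elim show "(1/2) ^ N * q (x - z) < r" by linarith
        qed
      qed
    qed
    then have "\<forall>\<^sub>F N in sequentially. \<forall>q\<in>F. \<forall>x\<in>C. \<forall>z\<in>C. (1/2) ^ N * q (x - z) < r"
      using F(1) by (intro eventually_ball_finite) auto
    then obtain N where N: "\<forall>q\<in>F. \<forall>x\<in>C. \<forall>z\<in>C. (1/2) ^ N * q (x - z) < r"
      unfolding eventually_sequentially by blast
    have "dyadic_sum y m x - dyadic_sum y n x \<in> U" if mn: "N \<le> m" "N \<le> n" for m n
    proof -
      obtain a where a: "a \<in> C" "dyadic_sum y m x = dyadic_sum y N a"
        using dyadic_sum_split[where y = y, OF C(2) y x mn(1)] by (rule bexE)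
      obtain b where b: "b \<in> C" "dyadic_sum y n x = dyadic_sum y N b"
        using dyadic_sum_split[where y = y, OF C(2) y x mn(2)] by (rule bexE)
      have "q (dyadic_sum y m x - dyadic_sum y n x) < r" if "q \<in> F" for q
      proof -
        have "q \<in> Q" using that F(2) by blast
        then show ?thesis
          using bspec[OF bspec[OF bspec[OF N that] a(1)] b(1)]
          by (simp add: a(2) b(2) dyadic_sum_diff seminorm_scaleR[OF seminorm])
      qed
      then show ?thesis
        using F(4) by auto
    qed
    then show ?thesis by blast
  qed
  then obtain l where l: "limitin X (\<lambda>m. dyadic_sum y m x) l sequentially"
    using complete[unfolded sequentially_complete_def, rule_format, of "\<lambda>m. dyadic_sum y m x"] by blast
  have "l \<in> C"
    using limitin_closedin[OF l weakly_compact_imp_closedin(2)[OF C(1)]] dyadic_sum_mem[OF C(2) y x] by simp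
  then show ?thesis
    using limitin_imp_seminorm_tendsto[OF l] by blast
qed

section \<open>Retractions onto common fixed point sets\<close>

definition nonexpansive_retraction :: "'a set \<Rightarrow> 'a set \<Rightarrow> ('a \<Rightarrow> 'a) \<Rightarrow> bool" where
  "nonexpansive_retraction C F r \<longleftrightarrow> nonexpansive_on Q C r \<and> (\<forall>x\<in>C. r x \<in> F) \<and> (\<forall>x\<in>F. r x = x)"

text \<open>In the induction step Bruck's theorem is applied to the composite of \<open>a n\<close>
  with the retraction \<open>r\<close> for the first \<open>n\<close> maps. If
  \<open>a n (r x) = x\<close>, commuting \<open>a i\<close> past \<open>a n\<close> shows that
  \<open>x\<close> is fixed by each earlier \<open>a i\<close>; then \<open>r x = x\<close>, and
  \<open>a n\<close> fixes \<open>x\<close> as well.\<close>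

lemma finite_commuting_retraction:
  fixes a :: "nat \<Rightarrow> 'a \<Rightarrow> 'a"
  assumes fpp: "weakly_fpp X Q" and C: "compactin (weak_topology X) C" "convex C"
    and a: "\<And>i. nonexpansive_on Q C (a i)"
    and commute: "\<And>i j x. x \<in> C \<Longrightarrow> a i (a j x) = a j (a i x)"
  shows "\<exists>r. nonexpansive_retraction C {x \<in> C. \<forall>i<n. a i x = x} r"
proof (induction n)
  case 0
  show ?case
    by (rule exI[of _ "\<lambda>x. x"]) (auto simp: nonexpansive_retraction_def nonexpansive_on_def)
next
  case (Suc n)
  then obtain r where r: "nonexpansive_on Q C r" "\<And>x. x \<in> C \<Longrightarrow> r x \<in> {x \<in> C. \<forall>i<n. a i x = x}"
      "\<And>x. x \<in> C \<Longrightarrow> \<forall>i<n. a i x = x \<Longrightarrow> r x = x"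
    unfolding nonexpansive_retraction_def by auto
  have Fix: "a n (r x) = x \<longleftrightarrow> (\<forall>i<Suc n. a i x = x)" if x: "x \<in> C" for x
  proof
    assume eq: "a n (r x) = x"
    have "a i x = x" if "i < n" for i
    proof -
      have rx: "r x \<in> C" "a i (r x) = r x" using r(2)[OF x] that by auto
      have "a i x = a i (a n (r x))" by (simp only: eq)
      also have "\<dots> = a n (a i (r x))" by (rule commute[OF rx(1)])
      also have "\<dots> = x" by (simp only: rx(2) eq)
      finally show ?thesis .
    qed
    with eq r(3)[OF x] show "\<forall>i<Suc n. a i x = x"
      by (simp add: less_Suc_eq)
  next
    assume "\<forall>i<Suc n. a i x = x"
    then show "a n (r x) = x"
      using r(3)[OF x] by simp
  qed
  obtain \<rho> where \<rho>: "nonexpansive_on Q C \<rho>" "\<And>x. x \<in> C \<Longrightarrow> a n (r (\<rho> x)) = \<rho> x"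
      "\<And>x. x \<in> C \<Longrightarrow> a n (r x) = x \<Longrightarrow> \<rho> x = x"
    using nonexpansive_retraction_onto_fixed_points[OF fpp C nonexpansive_on_compose[OF a r(1)]] by blast
  have "nonexpansive_retraction C {x \<in> C. \<forall>i<Suc n. a i x = x} \<rho>"
    unfolding nonexpansive_retraction_def
  proof (intro conjI ballI)
    fix x assume "x \<in> C"
    then show "\<rho> x \<in> {x \<in> C. \<forall>i<Suc n. a i x = x}"
      using \<rho>(2) nonexpansive_onD(1)[OF \<rho>(1)] Fix[of "\<rho> x"] by blast
  next
    fix x assume "x \<in> {x \<in> C. \<forall>i<Suc n. a i x = x}"
    then show "\<rho> x = x"
      using \<rho>(3) Fix by blast
  qed (fact \<rho>(1))
  then show ?case by blast
qed

text \<open>Bruck's averaging: with retractions \<open>r j\<close> onto a decreasing sequence of sets, a fixed point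
  \<open>x\<close> of \<open>\<Sum>j. 2 ^ - (j + 1) * r j\<close> satisfies \<open>q (x - r n x) \<le> sup j. q (x - r j x) / 2\<close> for all \<open>n\<close>.\<close>

lemma decreasing_retracts_common_point:
  assumes fpp: "weakly_fpp X Q" and complete: "sequentially_complete X"
    and C: "C \<noteq> {}" "compactin (weak_topology X) C" "convex C"
    and F: "\<And>n. F n \<subseteq> C" "decseq F"
    and r: "\<And>n. nonexpansive_retraction C (F n) (r n)"
  shows "(\<Inter>n. F n) \<noteq> {}"
proof -
  have r_nonexp: "nonexpansive_on Q C (r n)" and r_mem: "x \<in> C \<Longrightarrow> r n x \<in> F n" and r_fix: "x \<in> F n \<Longrightarrow> r n x = x" for n x
    using r unfolding nonexpansive_retraction_def by blast+
  have rC: "r n x \<in> C" if "x \<in> C" for n x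
    using r_mem[OF that] F(1) by blast
  have r_r: "r i (r j x) = r j x" if "i \<le> j" "x \<in> C" for i j x
    using r_fix r_mem[OF that(2)] decseqD[OF F(2) that(1)] by blast
  have "\<exists>l. l \<in> C \<and> (\<forall>q\<in>Q. (\<lambda>m. q (dyadic_sum (\<lambda>j. r j x) m x - l)) \<longlonglongrightarrow> 0)" if "x \<in> C" for x
    using dyadic_sum_limit[where y = "\<lambda>j. r j x", OF complete C(2,3) rC[OF that] that] by blast
  then obtain T where T: "\<And>x. x \<in> C \<Longrightarrow> T x \<in> C"
      "\<And>x q. x \<in> C \<Longrightarrow> q \<in> Q \<Longrightarrow> (\<lambda>m. q (dyadic_sum (\<lambda>j. r j x) m x - T x)) \<longlonglongrightarrow> 0"
    by metis
  have "nonexpansive_on Q C T"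
    unfolding nonexpansive_on_def
  proof (intro conjI ballI Pi_I)
    fix x z q assume xz: "x \<in> C" "z \<in> C" and q: "q \<in> Q"
    note S = seminorm[OF q]
    let ?s = "\<lambda>m x. dyadic_sum (\<lambda>j. r j x) m x"
    have "q (T x - T z) \<le> q (?s m x - T x) + q (x - z) + q (?s m z - T z)" for m
    proof -
      have "q (?s m x - ?s m z) \<le> q (x - z)"
        using nonexpansive_onD(2)[OF r_nonexp xz q] by (intro dyadic_sum_nonexpansive[OF S]) auto
      then show ?thesis
        using seminorm_diff_triangle[OF S, of "T x" "T z" "?s m x"] seminorm_diff_triangle[OF S, of "?s m x" "T z" "?s m z"]
          seminorm_diff_commute[OF S, of "T x" "?s m x"] by linarith
    qed
    moreover have "(\<lambda>m. q (?s m x - T x) + q (x - z) + q (?s m z - T z)) \<longlonglongrightarrow> 0 + q (x - z) + 0"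
      using xz q by (intro tendsto_add T(2) tendsto_const)
    ultimately show "q (T x - T z) \<le> q (x - z)"
      by (intro LIMSEQ_le_const[where X = "\<lambda>m. q (?s m x - T x) + q (x - z) + q (?s m z - T z)"]) auto
  qed (fact T(1))
  then obtain x where x: "x \<in> C" "T x = x"
    using fpp[unfolded weakly_fpp_def, rule_format, of C T] C by blast
  let ?s = "\<lambda>m. dyadic_sum (\<lambda>j. r j x) m x"
  have "q (r n x - x) \<le> 0" if q: "q \<in> Q" for q n
  proof -
    note S = seminorm[OF q]
    obtain D where D: "\<And>x y. x \<in> C \<Longrightarrow> y \<in> C \<Longrightarrow> q (x - y) \<le> D"
      using weakly_compact_seminorm_diameter[OF C(2) q] by blast
    define A where "A = (SUP n. q (r n x - x))"
    have le_A: "q (r n x - x) \<le> A" for n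
      unfolding A_def using D rC x(1) by (intro cSUP_upper bdd_aboveI2[where M = D]) auto
    have half: "q (r n x - x) \<le> A / 2" for n
    proof -
      define p where "p = r n x"
      define b where "b = q (p - x)"
      have pC: "p \<in> C" using rC[OF x(1)] by (simp add: p_def)
      \<comment> \<open>For \<open>j < n\<close> the map \<open>r j\<close> fixes \<open>p\<close>,
        which compares \<open>r j x\<close> with \<open>r j p\<close>. For \<open>j > n\<close>, in
        \<open>upper\<close>, it is \<open>r n\<close> that fixes \<open>r j x\<close>, which
        compares \<open>r n (r j x)\<close> with \<open>r n x\<close>.\<close>
      have lower: "q (r j x - p) \<le> b" if "j < n" for j
        using nonexpansive_onD(2)[OF r_nonexp x(1) pC q, of j] r_r[of j n x] that x(1) seminorm_diff_commute[OF S, of x p]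
        by (simp add: p_def b_def)
      have upper: "q (r j x - p) \<le> A" if "n < j" for j
        using nonexpansive_onD(2)[OF r_nonexp rC[OF x(1)] x(1) q, of n j] r_r[of n j x] that x(1) le_A[of j]
        by (simp add: p_def)
      have conv: "convex {v. q (v - p) \<le> A}"
        by (rule convex_on_sublevel[OF seminorm_diff_convex_on[OF S]])
      \<comment> \<open>The term of index \<open>n\<close> is \<open>p\<close> itself and
        contributes nothing. It takes half of the weight left after the first \<open>n\<close>
        terms, so the remaining tail counts with \<open>A / 2\<close> instead of
        \<open>A\<close>.\<close>
      have s_bound: "q (?s m - p) \<le> (1 - (1/2) ^ n) * b + (1/2) ^ n * (A / 2)" if m: "Suc n \<le> m" for m
      proof -
        have "x \<in> {v. q (v - p) \<le> A}"
          using le_A[of n] seminorm_diff_commute[OF S, of x p] by (simp add: p_def)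
        then obtain z where z: "q (z - p) \<le> A" "?s m = dyadic_sum (\<lambda>j. r j x) (Suc n) z"
          using dyadic_sum_split[OF conv, of "Suc n" "\<lambda>j. r j x" x m] upper m by auto
        have "(1/2) *\<^sub>R p + (1/2) *\<^sub>R z - p = (1/2) *\<^sub>R (p - p) + (1/2) *\<^sub>R (z - p)"
          by (simp add: algebra_simps flip: scaleR_add_left)
        then have "q ((1/2) *\<^sub>R p + (1/2) *\<^sub>R z - p) \<le> A / 2"
          using seminorm_half_sum[OF S, of "p - p" 0 "z - p" A] z(1) by (simp add: seminorm_0[OF S])
        then have weight: "(1/2) ^ n * q ((1/2) *\<^sub>R p + (1/2) *\<^sub>R z - p) \<le> (1/2) ^ n * (A / 2)"
          by (intro mult_left_mono) auto
        have dist: "q (dyadic_sum (\<lambda>j. r j x) n ((1/2) *\<^sub>R p + (1/2) *\<^sub>R z) - p)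
            \<le> (1 - (1/2) ^ n) * b + (1/2) ^ n * q ((1/2) *\<^sub>R p + (1/2) *\<^sub>R z - p)"
          by (rule dyadic_sum_dist_le[OF S lower])
        have "?s m = dyadic_sum (\<lambda>j. r j x) n ((1/2) *\<^sub>R p + (1/2) *\<^sub>R z)"
          using z(2) by (simp add: p_def)
        then show ?thesis
          by (simp only: order_trans[OF dist add_left_mono[OF weight]])
      qed
      have "b \<le> (1 - (1/2) ^ n) * b + (1/2) ^ n * (A / 2)"
      proof (rule LIMSEQ_le_const)
        show "(\<lambda>m. q (?s m - x) + ((1 - (1/2) ^ n) * b + (1/2) ^ n * (A / 2)))
            \<longlonglongrightarrow> (1 - (1/2) ^ n) * b + (1/2) ^ n * (A / 2)"
          using tendsto_add[OF T(2)[OF x(1) q] tendsto_const, of "(1 - (1/2) ^ n) * b + (1/2) ^ n * (A / 2)"] x(2) by simp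
        have "b \<le> q (?s m - x) + ((1 - (1/2) ^ n) * b + (1/2) ^ n * (A / 2))" if "Suc n \<le> m" for m
          using s_bound[OF that] seminorm_diff_triangle[OF S, of p x "?s m"] seminorm_diff_commute[OF S, of p "?s m"]
          by (simp add: b_def)
        then show "\<exists>N. \<forall>m\<ge>N. b \<le> q (?s m - x) + ((1 - (1/2) ^ n) * b + (1/2) ^ n * (A / 2))"
          by blast
      qed
      then have "(1/2) ^ n * b \<le> (1/2) ^ n * (A / 2)"
        by (simp add: algebra_simps)
      then show ?thesis
        by (simp add: b_def p_def)
    qed
    have "A \<le> A / 2"
      unfolding A_def using half by (intro cSUP_least) (auto simp: A_def)
    then show ?thesis
      using le_A[of n] by linarith
  qed
  then have "r n x = x" for n
    by (simp add: eq_iff_seminorms)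
  then have "x \<in> F n" for n
    using r_mem[OF x(1), of n] by simp
  then show ?thesis by blast
qed

lemma countable_commuting_fixed_point:
  assumes fpp: "weakly_fpp X Q" and complete: "sequentially_complete X"
    and C: "C \<noteq> {}" "compactin (weak_topology X) C" "convex C"
    and a: "\<And>i::nat. nonexpansive_on Q C (a i)"
    and commute: "\<And>i j x. x \<in> C \<Longrightarrow> a i (a j x) = a j (a i x)"
  shows "\<exists>x\<in>C. \<forall>i. a i x = x"
proof -
  define F where "F n = {x \<in> C. \<forall>i<n. a i x = x}" for n
  have "\<exists>r. nonexpansive_retraction C (F n) r" for n
    unfolding F_def by (rule finite_commuting_retraction[OF fpp C(2,3) a commute])
  then obtain r where r: "\<And>n. nonexpansive_retraction C (F n) (r n)"
    by metis
  have "(\<Inter>n. F n) \<noteq> {}"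
    by (rule decreasing_retracts_common_point[OF fpp complete C _ _ r])
      (auto simp: F_def decseq_def)
  then show ?thesis
    unfolding F_def by blast
qed

end

section \<open>Arbitrary commuting families\<close>

text \<open>The infimum is the \<open>p\<close>-distance from \<open>y\<close> to \<open>D\<close>.
  The closure of \<open>D\<close> will be described by such distances being \<open>\<le> 0\<close>,
  which fits the criterion for weakly closed sublevel sets.\<close>

lemma INF_seminorm_dist:
  assumes p: "seminorm p" and D: "D \<noteq> {}"
  shows INF_seminorm_dist_less_iff: "(INF d\<in>D. p (y - d)) < c \<longleftrightarrow> (\<exists>d\<in>D. p (y - d) < c)"
    and INF_seminorm_dist_add_le: "(INF d\<in>D. p (y + v - d)) \<le> (INF d\<in>D. p (y - d)) + p v"
proof -
  have bdd: "bdd_below ((\<lambda>d. p (y - d)) ` D)" for y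
    using seminorm_nonneg[OF p] by (intro bdd_belowI2[where m = 0])
  show "(INF d\<in>D. p (y - d)) < c \<longleftrightarrow> (\<exists>d\<in>D. p (y - d) < c)"
    by (rule cINF_less_iff[OF D bdd])
  have "(INF d\<in>D. p (y + v - d)) - p v \<le> (INF d\<in>D. p (y - d))"
  proof (rule cINF_greatest[OF D])
    fix d assume "d \<in> D"
    then have "(INF d\<in>D. p (y + v - d)) \<le> p (y + v - d)"
      by (rule cINF_lower[OF bdd])
    also have "\<dots> \<le> p (y - d) + p v"
      using seminorm_add_le[OF p, of "y - d" v] by (simp add: algebra_simps)
    finally show "(INF d\<in>D. p (y + v - d)) - p v \<le> p (y - d)" by simp
  qed
  then show "(INF d\<in>D. p (y + v - d)) \<le> (INF d\<in>D. p (y - d)) + p v" by simp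
qed

text \<open>Only rational combinations are assumed since \<open>D\<close> has to stay countable.
  Replacing a real coefficient by a nearby rational one moves the combination by an arbitrarily
  small \<open>p\<close>-distance, which the infimum does not see.\<close>

lemma rational_convex_INF_seminorm_dist_convex_on:
  assumes p: "seminorm p" and D: "D \<noteq> {}"
    and comb: "\<And>d e c. d \<in> D \<Longrightarrow> e \<in> D \<Longrightarrow> c \<in> \<rat> \<inter> {0..1} \<Longrightarrow> (1 - c) *\<^sub>R d + c *\<^sub>R e \<in> D"
  shows "convex_on UNIV (\<lambda>y. INF d\<in>D. p (y - d))"
proof (intro convex_onI)
  fix t :: real and x y assume t: "0 < t" "t < 1"
  define \<phi> where "\<phi> y = (INF d\<in>D. p (y - d))" for y
  have less_iff: "\<phi> y < c \<longleftrightarrow> (\<exists>d\<in>D. p (y - d) < c)" for y c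
    unfolding \<phi>_def by (rule INF_seminorm_dist_less_iff[OF p D])
  have "\<phi> ((1 - t) *\<^sub>R x + t *\<^sub>R y) \<le> (1 - t) * \<phi> x + t * \<phi> y + \<epsilon>" if \<epsilon>: "0 < \<epsilon>" for \<epsilon>
  proof -
    obtain d where d: "d \<in> D" "p (x - d) < \<phi> x + \<epsilon> / 2"
      using less_iff[of x "\<phi> x + \<epsilon> / 2"] \<epsilon> by auto
    obtain e where e: "e \<in> D" "p (y - e) < \<phi> y + \<epsilon> / 2"
      using less_iff[of y "\<phi> y + \<epsilon> / 2"] \<epsilon> by auto
    \<comment> \<open>The summand 1 avoids division by zero. \<open>\<delta>\<close> is the error
      allowed in \<open>c\<close> so that replacing \<open>t\<close> by \<open>c\<close> costs at
      most \<open>\<epsilon> / 2\<close>; the maximum with 0 below keeps \<open>c\<close> in the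
      unit interval.\<close>
    define w where "w = 1 + p (e - d)"
    define \<delta> where "\<delta> = \<epsilon> / 2 / w"
    have pos: "0 < w" "p (e - d) \<le> w"
      using seminorm_nonneg[OF p, of "e - d"] by (simp_all add: w_def)
    then have "0 < \<delta>" using \<epsilon> by (simp add: \<delta>_def)
    then have "max 0 (t - \<delta>) < t" using t by simp
    then obtain c where c: "c \<in> \<rat>" "max 0 (t - \<delta>) < c" "c < t"
      using Rats_dense_in_real by blast
    have "(t - c) * p (e - d) \<le> \<delta> * w"
      using c pos seminorm_nonneg[OF p, of "e - d"] \<open>0 < \<delta>\<close> by (intro mult_mono) auto
    also have "\<dots> = \<epsilon> / 2" using pos by (simp add: \<delta>_def)
    finally have small: "(t - c) * p (e - d) \<le> \<epsilon> / 2" .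
    let ?z = "(1 - c) *\<^sub>R d + c *\<^sub>R e"
    have "?z \<in> D" using c t d e by (intro comb) auto
    have "(1 - t) *\<^sub>R x + t *\<^sub>R y - ?z = ((1 - t) *\<^sub>R (x - d) + t *\<^sub>R (y - e)) + (t - c) *\<^sub>R (e - d)"
      by (simp add: algebra_simps)
    then have "p ((1 - t) *\<^sub>R x + t *\<^sub>R y - ?z) \<le> (1 - t) * p (x - d) + t * p (y - e) + (t - c) * p (e - d)"
      using seminorm_add_le[OF p, of "(1 - t) *\<^sub>R (x - d) + t *\<^sub>R (y - e)" "(t - c) *\<^sub>R (e - d)"]
        seminorm_add_le[OF p, of "(1 - t) *\<^sub>R (x - d)" "t *\<^sub>R (y - e)"] t c
      by (simp add: seminorm_scaleR[OF p])
    also have "\<dots> < ((1 - t) * (\<phi> x + \<epsilon> / 2) + t * (\<phi> y + \<epsilon> / 2)) + \<epsilon> / 2"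
      using t d e small by (intro add_less_le_mono add_strict_mono mult_strict_left_mono) auto
    also have "\<dots> = (1 - t) * \<phi> x + t * \<phi> y + \<epsilon>"
      by (simp add: field_simps)
    finally show ?thesis
      using less_iff \<open>?z \<in> D\<close> by (meson less_imp_le)
  qed
  then show "(INF d\<in>D. p ((1 - t) *\<^sub>R x + t *\<^sub>R y - d)) \<le> (1 - t) * (INF d\<in>D. p (x - d)) + t * (INF d\<in>D. p (y - d))"
    unfolding \<phi>_def by (rule field_le_epsilon)
qed auto

lemma countable_closure_under_binary_operations:
  fixes op :: "nat \<Rightarrow> 'a \<Rightarrow> 'a \<Rightarrow> 'a"
  assumes x: "x \<in> K" and op: "\<And>n d e. d \<in> K \<Longrightarrow> e \<in> K \<Longrightarrow> op n d e \<in> K"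
  shows "\<exists>D. countable D \<and> x \<in> D \<and> D \<subseteq> K \<and> (\<forall>n. \<forall>d\<in>D. \<forall>e\<in>D. op n d e \<in> D)"
proof -
  define step where "step G = G \<union> (\<lambda>(n, d, e). op n d e) ` (UNIV \<times> G \<times> G)" for G
  define E where "E n = (step ^^ n) {x}" for n
  have E_0: "E 0 = {x}" and E_Suc: "E (Suc n) = step (E n)" for n
    by (simp_all add: E_def)
  have "incseq E"
    by (rule incseq_SucI) (auto simp: E_Suc step_def)
  show ?thesis
  proof (intro exI conjI allI ballI)
    have "countable (E n)" for n
      by (induction n) (auto simp: E_0 E_Suc step_def)
    then show "countable (\<Union>n. E n)" by simp
    show "x \<in> (\<Union>n. E n)" using E_0 by blast
    have "E n \<subseteq> K" for n
      by (induction n) (use x op in \<open>auto simp: E_0 E_Suc step_def subset_iff\<close>)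
    then show "(\<Union>n. E n) \<subseteq> K" by blast
    fix n d e assume "d \<in> (\<Union>n. E n)" "e \<in> (\<Union>n. E n)"
    then obtain i j where "d \<in> E i" "e \<in> E j" by blast
    then have "d \<in> E (max i j)" "e \<in> E (max i j)"
      using incseqD[OF \<open>incseq E\<close>, of i "max i j"] incseqD[OF \<open>incseq E\<close>, of j "max i j"] by auto
    then have "op n d e \<in> E (Suc (max i j))"
      unfolding E_Suc step_def by force
    then show "op n d e \<in> (\<Union>n. E n)" by blast
  qed
qed

lemma Sup_approximating_sequence:
  fixes g :: "'b \<Rightarrow> real"
  assumes "I \<noteq> {}" "\<And>i. i \<in> I \<Longrightarrow> g i \<le> B"
  obtains s :: "nat \<Rightarrow> 'b" where "\<And>n. s n \<in> I" "\<And>i \<epsilon>. i \<in> I \<Longrightarrow> 0 < \<epsilon> \<Longrightarrow> \<exists>n. g i < g (s n) + \<epsilon>"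
proof -
  have bdd: "bdd_above (g ` I)"
    using assms(2) by (intro bdd_aboveI2[where M = B])
  have "\<exists>i\<in>I. (SUP i\<in>I. g i) - inverse (real (Suc n)) < g i" for n
    using less_cSUP_iff[OF assms(1) bdd, of "(SUP i\<in>I. g i) - inverse (real (Suc n))"] by simp
  then obtain s where s: "\<And>n. s n \<in> I" "\<And>n. (SUP i\<in>I. g i) - inverse (real (Suc n)) < g (s n)"
    by metis
  show thesis
  proof
    fix i and \<epsilon> :: real assume "i \<in> I" "0 < \<epsilon>"
    obtain n where "inverse (real (Suc n)) < \<epsilon>"
      using reals_Archimedean[OF \<open>0 < \<epsilon>\<close>] by blast
    with s(2)[of n] cSUP_upper[OF \<open>i \<in> I\<close> bdd] have "g i < g (s n) + \<epsilon>"
      by linarith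
    then show "\<exists>n. g i < g (s n) + \<epsilon>" by blast
  qed (fact s(1))
qed

context separated_lcs
begin

text \<open>Reduction to countably many maps: \<open>D\<close> is countable and closed under rational convex
  combinations and under a countable subfamily which, at each point \<open>d\<close> of \<open>D\<close>, approximates the
  supremum of \<open>q (T d - d)\<close> over the whole family. A common fixed point of the subfamily in the
  closure of \<open>D\<close> then satisfies \<open>q (T x - x) = 0\<close> for every \<open>T\<close>.\<close>

lemma commuting_fixed_point_modulo_seminorm:
  assumes fpp: "weakly_fpp X Q" and complete: "sequentially_complete X"
    and K: "K \<noteq> {}" "compactin (weak_topology X) K" "convex K"
    and \<T>: "\<And>T. T \<in> \<T> \<Longrightarrow> nonexpansive_on Q K T"
    and commute: "\<And>S T x. S \<in> \<T> \<Longrightarrow> T \<in> \<T> \<Longrightarrow> x \<in> K \<Longrightarrow> S (T x) = T (S x)"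
    and q: "q \<in> Q"
  shows "\<exists>x\<in>K. \<forall>T\<in>\<T>. q (T x - x) \<le> 0"
proof (cases "\<T> = {}")
  case False
  obtain x0 where x0: "x0 \<in> K" using K(1) by blast
  have TK: "T x \<in> K" if "T \<in> \<T>" "x \<in> K" for T x
    using nonexpansive_onD(1)[OF \<T>[OF that(1)] that(2)] .
  obtain B where B: "\<And>x y. x \<in> K \<Longrightarrow> y \<in> K \<Longrightarrow> q (x - y) \<le> B"
    using weakly_compact_seminorm_diameter[OF K(2) q] by blast
  have "\<exists>s. (\<forall>n. s n \<in> \<T>) \<and> (\<forall>T \<epsilon>. T \<in> \<T> \<longrightarrow> 0 < \<epsilon> \<longrightarrow> (\<exists>n::nat. q (T x - x) < q (s n x - x) + \<epsilon>))"
    if x: "x \<in> K" for x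
  proof -
    have "q (T x - x) \<le> B" if "T \<in> \<T>" for T
      by (rule B[OF TK[OF that x] x])
    then obtain s :: "nat \<Rightarrow> 'a \<Rightarrow> 'a" where "\<And>n. s n \<in> \<T>"
        "\<And>T \<epsilon>. T \<in> \<T> \<Longrightarrow> 0 < \<epsilon> \<Longrightarrow> \<exists>n. q (T x - x) < q (s n x - x) + \<epsilon>"
      using Sup_approximating_sequence[OF False, of "\<lambda>T. q (T x - x)" B] by blast
    then show ?thesis by blast
  qed
  then obtain s :: "'a \<Rightarrow> nat \<Rightarrow> 'a \<Rightarrow> 'a" where s: "\<And>x n. x \<in> K \<Longrightarrow> s x n \<in> \<T>"
      "\<And>x T \<epsilon>. x \<in> K \<Longrightarrow> T \<in> \<T> \<Longrightarrow> 0 < \<epsilon> \<Longrightarrow> \<exists>n. q (T x - x) < q (s x n x - x) + \<epsilon>"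
    by metis
  define C :: "real set" where "C = \<rat> \<inter> {0..1}"
  have C: "C \<noteq> {}" "countable C"
    by (auto simp: C_def countable_rat)
  \<comment> \<open>Even indices apply to \<open>d\<close> a map chosen at the point
    \<open>e\<close>; odd indices form rational convex combinations. The binary form lets the family
    of maps grow along with \<open>D\<close>, so that \<open>D\<close> is closed under the maps
    attached to all its own points.\<close>
  define op where "op n d e = (if even n then s e (n div 2) d
      else (1 - from_nat_into C (n div 2)) *\<^sub>R d + from_nat_into C (n div 2) *\<^sub>R e)" for n d e
  have op_K: "op n d e \<in> K" if "d \<in> K" "e \<in> K" for n d e
  proof (cases "even n")
    case True
    then show ?thesis using TK[OF s(1)] that by (simp add: op_def)
  next
    case False
    have "from_nat_into C (n div 2) \<in> C" by (rule from_nat_into[OF C(1)])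
    then have "(1 - from_nat_into C (n div 2)) *\<^sub>R d + from_nat_into C (n div 2) *\<^sub>R e \<in> K"
      using that by (intro convexD[OF K(3)]) (auto simp: C_def)
    then show ?thesis using False by (simp add: op_def)
  qed
  have "\<exists>D. countable D \<and> x0 \<in> D \<and> D \<subseteq> K \<and> (\<forall>n. \<forall>d\<in>D. \<forall>e\<in>D. op n d e \<in> D)"
    by (rule countable_closure_under_binary_operations[OF x0 op_K])
  then obtain D where D: "countable D" "x0 \<in> D" "D \<subseteq> K" and D_op: "\<forall>n. \<forall>d\<in>D. \<forall>e\<in>D. op n d e \<in> D"
    by (elim exE conjE)
  have D_ne: "D \<noteq> {}" using D(2) by blast
  have D_map: "s e n d \<in> D" if "d \<in> D" "e \<in> D" for n d e
    using D_op[rule_format, OF that, of "2 * n"] by (simp add: op_def)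
  have D_comb: "(1 - c) *\<^sub>R d + c *\<^sub>R e \<in> D" if "d \<in> D" "e \<in> D" "c \<in> \<rat> \<inter> {0..1}" for d e c
  proof -
    have "c \<in> range (from_nat_into C)"
      unfolding range_from_nat_into[OF C] using that(3) by (simp add: C_def)
    then obtain n where "from_nat_into C n = c"
      by blast
    then show ?thesis
      using D_op[rule_format, OF that(1,2), of "2 * n + 1"] by (simp add: op_def)
  qed
  define \<phi> where "\<phi> F y = (INF d\<in>D. \<Sum>q\<in>F. q (y - d))" for F :: "('a \<Rightarrow> real) set" and y
  define \<F> where "\<F> = {F. finite F \<and> F \<subseteq> Q}"
  \<comment> \<open>This is the closure of \<open>D\<close> in \<open>K\<close> for the topology
    given by \<open>Q\<close>. Written with distance functions, it is visibly convex and weakly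
    compact.\<close>
  define K' where "K' = K \<inter> (\<Inter>F\<in>\<F>. {y. \<phi> F y \<le> 0})"
  have \<phi>: "convex_on UNIV (\<phi> F)" "\<phi> F (y + v) \<le> \<phi> F y + (\<Sum>q\<in>F. q v)"
    "\<phi> F y < c \<longleftrightarrow> (\<exists>d\<in>D. (\<Sum>q\<in>F. q (y - d)) < c)" if "F \<in> \<F>" for F y v c
  proof -
    have S: "seminorm (\<lambda>x. \<Sum>q\<in>F. q x)"
      using that by (intro seminorm_finite_sum) (simp add: \<F>_def)
    show "convex_on UNIV (\<phi> F)"
      using rational_convex_INF_seminorm_dist_convex_on[OF S D_ne D_comb] by (simp add: \<phi>_def[abs_def])
    show "\<phi> F (y + v) \<le> \<phi> F y + (\<Sum>q\<in>F. q v)"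
      unfolding \<phi>_def by (rule INF_seminorm_dist_add_le[OF S D_ne])
    show "\<phi> F y < c \<longleftrightarrow> (\<exists>d\<in>D. (\<Sum>q\<in>F. q (y - d)) < c)"
      unfolding \<phi>_def by (rule INF_seminorm_dist_less_iff[OF S D_ne])
  qed
  have K'_iff: "y \<in> K' \<longleftrightarrow> y \<in> K \<and> (\<forall>F\<in>\<F>. \<forall>\<epsilon>>0. \<exists>d\<in>D. (\<Sum>q\<in>F. q (y - d)) < \<epsilon>)" for y
  proof -
    have "\<phi> F y \<le> 0 \<longleftrightarrow> (\<forall>\<epsilon>>0. \<phi> F y < \<epsilon>)" for F
      by (meson less_le_not_le not_le order_le_less_trans)
    then show ?thesis
      unfolding K'_def using \<phi>(3) by auto
  qed
  have "{} \<in> \<F>" by (simp add: \<F>_def)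
  have "closedin (weak_topology X) (\<Inter>F\<in>\<F>. {y. \<phi> F y \<le> 0})"
  proof (rule closedin_INT)
    show "\<F> \<noteq> {}" using \<open>{} \<in> \<F>\<close> by blast
    show "closedin (weak_topology X) {y. \<phi> F y \<le> 0}" if "F \<in> \<F>" for F
      using that \<phi>[OF that] by (intro weakly_closed_sublevel[where F = F]) (auto simp: \<F>_def)
  qed
  then have K'_compact: "compactin (weak_topology X) K'"
    unfolding K'_def by (rule compact_Int_closedin[OF K(2)])
  have K'_convex: "convex K'"
    unfolding K'_def by (intro convex_Int convex_INT K(3) convex_on_sublevel \<phi>(1))
  have "x0 \<in> K'"
    unfolding K'_iff
  proof (intro conjI ballI allI impI x0)
    fix F and \<epsilon> :: real assume "F \<in> \<F>" "0 < \<epsilon>"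
    then have "(\<Sum>q\<in>F. q (x0 - x0)) < \<epsilon>"
      using seminorm_0[OF seminorm_finite_sum, of F] by (simp add: \<F>_def)
    then show "\<exists>d\<in>D. (\<Sum>q\<in>F. q (x0 - d)) < \<epsilon>"
      using D(2) by blast
  qed
  then have K'_ne: "K' \<noteq> {}" by blast
  have K'K: "K' \<subseteq> K" by (auto simp: K'_def)
  have K'_nonexp: "nonexpansive_on Q K' (s e n)" if e: "e \<in> D" for e n
  proof -
    have N: "nonexpansive_on Q K (s e n)"
      using \<T> s(1) D(3) e by blast
    have "s e n y \<in> K'" if y': "y \<in> K'" for y
      unfolding K'_iff
    proof (intro conjI ballI allI impI)
      have y: "y \<in> K" using y' K'K by blast
      then show "s e n y \<in> K" by (rule nonexpansive_onD(1)[OF N])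
      fix F and \<epsilon> :: real assume F: "F \<in> \<F>" and "0 < \<epsilon>"
      then obtain d where d: "d \<in> D" "(\<Sum>q\<in>F. q (y - d)) < \<epsilon>"
        using y' unfolding K'_iff by blast
      have "(\<Sum>q\<in>F. q (s e n y - s e n d)) \<le> (\<Sum>q\<in>F. q (y - d))"
        using F d(1) D(3) by (intro sum_mono nonexpansive_onD(2)[OF N y]) (auto simp: \<F>_def)
      with d D_map[OF d(1) e] show "\<exists>d\<in>D. (\<Sum>q\<in>F. q (s e n y - d)) < \<epsilon>"
        by (intro bexI[of _ "s e n d"]) auto
    qed
    then show ?thesis
      using N K'K unfolding nonexpansive_on_def by blast
  qed
  define \<A> where "\<A> = (\<lambda>(e, n). s e n) ` (D \<times> UNIV)"
  have \<A>: "\<A> \<noteq> {}" "countable \<A>"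
    using D(1) D_ne by (auto simp: \<A>_def)
  have \<A>_nonexp: "nonexpansive_on Q K' T" and \<A>\<T>: "T \<in> \<T>" if "T \<in> \<A>" for T
    using that K'_nonexp s(1) D(3) by (auto simp: \<A>_def)
  have mem: "from_nat_into \<A> i \<in> \<A>" for i
    by (rule from_nat_into[OF \<A>(1)])
  have "\<exists>x\<in>K'. \<forall>i. from_nat_into \<A> i x = x"
  proof (rule countable_commuting_fixed_point[OF fpp complete K'_ne K'_compact K'_convex])
    show "nonexpansive_on Q K' (from_nat_into \<A> i)" for i
      by (rule \<A>_nonexp[OF mem])
    show "from_nat_into \<A> i (from_nat_into \<A> j x) = from_nat_into \<A> j (from_nat_into \<A> i x)" if "x \<in> K'" for i j x
      using that K'K by (intro commute \<A>\<T> mem) auto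
  qed
  then obtain x where x: "x \<in> K'" "\<And>i. from_nat_into \<A> i x = x"
    by blast
  have fixed: "s e n x = x" if "e \<in> D" for e n
  proof -
    have "s e n \<in> range (from_nat_into \<A>)"
      unfolding range_from_nat_into[OF \<A>] using that by (auto simp: \<A>_def)
    then show ?thesis using x(2) by auto
  qed
  have xK: "x \<in> K" using x(1) K'K by blast
  note S = seminorm[OF q]
  have "q (T x - x) \<le> 0" if T: "T \<in> \<T>" for T
  proof (rule field_le_epsilon)
    fix \<epsilon> :: real assume "0 < \<epsilon>"
    have "{q} \<in> \<F>" using q by (simp add: \<F>_def)
    \<comment> \<open>Moving between \<open>x\<close> and a nearby \<open>d\<close> costs
      \<open>q (x - d)\<close> four times: twice for \<open>T\<close> and twice for the
      approximating map at \<open>d\<close>, which fixes \<open>x\<close>. The approximation of the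
      supremum takes the last fifth.\<close>
    moreover have "0 < \<epsilon> / 5" using \<open>0 < \<epsilon>\<close> by simp
    ultimately obtain d where d: "d \<in> D" "q (x - d) < \<epsilon> / 5"
      using x(1) unfolding K'_iff by fastforce
    have dK: "d \<in> K" using d(1) D(3) by blast
    obtain n where n: "q (T d - d) < q (s d n d - d) + \<epsilon> / 5"
      using s(2)[OF dK T \<open>0 < \<epsilon> / 5\<close>] by blast
    have "q (s d n d - x) \<le> q (d - x)"
      using nonexpansive_onD(2)[OF \<T>[OF s(1)[OF dK]] dK xK q] fixed[OF d(1)] by simp
    moreover have "q (T x - T d) \<le> q (x - d)"
      by (rule nonexpansive_onD(2)[OF \<T>[OF T] xK dK q])
    moreover have "q (d - x) = q (x - d)"
      by (rule seminorm_diff_commute[OF S])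
    moreover have "q (T x - x) \<le> q (T x - T d) + (q (T d - d) + q (d - x))"
      using seminorm_diff_triangle[OF S, of "T x" x "T d"] seminorm_diff_triangle[OF S, of "T d" x d] by linarith
    moreover have "q (s d n d - d) \<le> q (s d n d - x) + q (x - d)"
      by (rule seminorm_diff_triangle[OF S])
    ultimately show "q (T x - x) \<le> 0 + \<epsilon>"
      using n d(2) by linarith
  qed
  then show ?thesis using xK by blast
qed (use K(1) in auto)

text \<open>The minimal set is chosen before any seminorm, so every \<open>q\<close> may bring its
  own approximate fixed point: each one constrains the same \<open>M\<close>.\<close>

lemma commuting_family_fixed_point:
  assumes fpp: "weakly_fpp X Q" and complete: "sequentially_complete X"
    and C: "C \<noteq> {}" "compactin (weak_topology X) C" "convex C"
    and \<T>: "\<And>T. T \<in> \<T> \<Longrightarrow> nonexpansive_on Q C T"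
    and commute: "\<And>S T x. S \<in> \<T> \<Longrightarrow> T \<in> \<T> \<Longrightarrow> x \<in> C \<Longrightarrow> S (T x) = T (S x)"
  shows "\<exists>x\<in>C. \<forall>T\<in>\<T>. T x = x"
proof -
  let ?Y = "subtopology (weak_topology X) C"
  define P where "P K \<longleftrightarrow> convex K \<and> (\<forall>T\<in>\<T>. T ` K \<subseteq> K)" for K
  obtain M where M: "closedin ?Y M" "M \<noteq> {}" "P M"
    and min: "\<And>A. closedin ?Y A \<Longrightarrow> A \<noteq> {} \<Longrightarrow> P A \<Longrightarrow> A \<subseteq> M \<Longrightarrow> A = M"
  proof (rule compact_space_minimal_closed[where Y = ?Y and P = P])
    show "compact_space ?Y"
      by (rule compact_space_subtopology[OF C(2)])
    show "topspace ?Y \<noteq> {}" using C(1) by simp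
    show "P (topspace ?Y)"
      using C(3) nonexpansive_onD(1)[OF \<T>] by (auto simp: P_def)
    show "P (\<Inter>\<C>)" if "\<C> \<noteq> {}" "\<And>A. A \<in> \<C> \<Longrightarrow> P A" for \<C>
      unfolding P_def
    proof
      show "convex (\<Inter>\<C>)"
        using that(2) unfolding P_def by (intro convex_Inter) blast
      show "\<forall>T\<in>\<T>. T ` \<Inter>\<C> \<subseteq> \<Inter>\<C>"
        using that(2) unfolding P_def by blast
    qed
  qed blast
  have closed_M: "closedin (weak_topology X) M" and MC: "M \<subseteq> C"
    using M(1) closedin_closed_subtopology[OF weakly_compact_imp_closedin(1)[OF C(2)]] by auto
  have compact_M: "compactin (weak_topology X) M"
    by (rule closed_compactin[OF C(2) MC closed_M])
  have TM: "T y \<in> M" if "T \<in> \<T>" "y \<in> M" for T y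
    using M(3) that unfolding P_def by auto
  have convex_M: "convex M"
    using M(3) unfolding P_def by blast
  have nonexp: "nonexpansive_on Q M T" if "T \<in> \<T>" for T
    using \<T>[OF that] TM[OF that] MC unfolding nonexpansive_on_def by blast
  have "q (y - z) \<le> 0" if q: "q \<in> Q" and yz: "y \<in> M" "z \<in> M" for q y z
  proof -
    note S = seminorm[OF q]
    have "\<exists>x\<in>M. \<forall>T\<in>\<T>. q (T x - x) \<le> 0"
      using commute MC by (intro commuting_fixed_point_modulo_seminorm[OF fpp complete M(2) compact_M convex_M nonexp _ q]) auto
    then obtain x where x: "x \<in> M" "\<And>T. T \<in> \<T> \<Longrightarrow> q (T x - x) \<le> 0"
      by blast
    \<comment> \<open>Each \<open>T\<close> moves \<open>x\<close> by \<open>q\<close>-distance 0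
      and does not increase the distance from \<open>v\<close> to \<open>x\<close>, which gives
      invariance; the ball is weakly closed and convex.\<close>
    define A where "A = M \<inter> {y. q (y - x) \<le> 0}"
    have "A = M"
    proof (rule min)
      show "closedin ?Y A"
        unfolding A_def closedin_closed_subtopology[OF weakly_compact_imp_closedin(1)[OF C(2)]]
        using closed_M weakly_closed_ball[OF q] MC by blast
      show "A \<noteq> {}"
        using x(1) seminorm_0[OF S] by (auto simp: A_def)
      show "P A"
        unfolding P_def
      proof (intro conjI ballI subsetI)
        show "convex A"
          unfolding A_def by (intro convex_Int convex_M convex_on_sublevel seminorm_diff_convex_on S)
        fix T u assume T: "T \<in> \<T>" and "u \<in> T ` A"
        then obtain v where v: "v \<in> M" "q (v - x) \<le> 0" "u = T v"
          by (auto simp: A_def)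
        have "q (T v - x) \<le> 0"
          using seminorm_diff_triangle[OF S, of "T v" x "T x"] nonexpansive_onD(2)[OF nonexp[OF T] v(1) x(1) q] v(2) x(2)[OF T]
          by linarith
        then show "u \<in> A"
          using TM[OF T v(1)] by (simp add: A_def v(3))
      qed
    qed (simp add: A_def)
    then have "q (y - x) \<le> 0" "q (z - x) \<le> 0"
      using yz by (auto simp: A_def)
    then show ?thesis
      using seminorm_diff_triangle[OF S, of y z x] seminorm_diff_commute[OF S, of z x] by linarith
  qed
  then have single: "y = z" if "y \<in> M" "z \<in> M" for y z
    using that by (simp add: eq_iff_seminorms)
  obtain x where x: "x \<in> M" using M(2) by blast
  then have "T x = x" if "T \<in> \<T>" for T
    using single TM[OF that] by blast
  then show ?thesis
    using x MC by blast
qed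

end

theorem theorem5p3:
  fixes X :: "'a::real_vector topology" and Q :: "('a \<Rightarrow> real) set"
  assumes "locally_convex_space X"
    and "\<And>q. q \<in> Q \<Longrightarrow> seminorm q"
    and "determines_topology Q X"
    and "separated Q"
    and "sequentially_complete X"
    and "weakly_fpp X Q"
  shows "weakly_fpp_commuting_separable TYPE('s) X Q"
  unfolding weakly_fpp_commuting_separable_def
proof (intro allI impI, elim conjE)
  fix C and S :: "'s topology" and mul T
  assume C: "C \<noteq> {}" "weakly_compact X C" "convex C"
    and S: "semitopological_semigroup S mul" "commuting S mul"
    and T: "nonexpansive_representation Q C S mul T"
  interpret separated_lcs X Q
    by unfold_locales (use assms in \<open>auto simp: locally_convex_space_def\<close>)
  have mult: "T (mul s t) x = T s (T t x)" if "s \<in> topspace S" "t \<in> topspace S" "x \<in> C" for s t x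
    using T that unfolding nonexpansive_representation_def by blast
  have comm: "T s (T t x) = T t (T s x)" if "s \<in> topspace S" "t \<in> topspace S" "x \<in> C" for s t x
    using mult[OF that] mult[OF that(2,1,3)] S(2) that(1,2) unfolding commuting_def by simp
  have "\<exists>x\<in>C. \<forall>f\<in>T ` topspace S. f x = x"
  proof (rule commuting_family_fixed_point[OF assms(6,5) C])
    show "nonexpansive_on Q C f" if "f \<in> T ` topspace S" for f
      using T that unfolding nonexpansive_representation_def by blast
    show "f (g x) = g (f x)" if "f \<in> T ` topspace S" "g \<in> T ` topspace S" "x \<in> C" for f g x
      using that comm by blast
  qed
  then show "Fix C S T \<noteq> {}"
    unfolding Fix_def by blast
qed

end
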